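(* Let $X$ and $Y$ be complex abelian surfaces. For any admissible Hodge isometry $\psi\colon H^2(X,\mathbb{Q})\xrightarrow{\sim}H^2(Y,\mathbb{Q})$ there exist an integer $d$ and an isogeny $f\colon Y\to X$ of degree $d^2$ such that $\psi=\frac{f^*}{d}$.
   Context: For a complex abelian surface $X$ one has $H^\bullet(X,\mathbb{Q})=\bigwedge^\bullet H^1(X,\mathbb{Q})$, with trace map $\mathrm{tr}_X\colon H^4(X,\mathbb{Q})\xrightarrow{\sim}\mathbb{Q}$; the pairing on $H^2$ is $\langle\alpha,\beta\rangle=\mathrm{tr}_X(\alpha\wedge\beta)$. A basis $\{v_1,v_2,v_3,v_4\}$ of $H^1(X,\mathbb{Q})$ is admissible if $\mathrm{tr}_X(v_1\wedge v_2\wedge v_3\wedge v_4)=1$; the associated basis $\{v_i\wedge v_j\}_{i<j}$ (in lexicographic order) of $H^2(X,\mathbb{Q})$ is also called admissible. A Hodge isometry $\psi\colon H^2(X,\mathbb{Q})\to H^2(Y,\mathbb{Q})$ is an isomorphism of $\mathbb{Q}$-Hodge structures preserving the pairings; it is admissible if its matrix with respect to admissible bases of $H^2(X,\mathbb{Q})$ and $H^2(Y,\mathbb{Q})$ has determinant $1$ (independent of the choice of admissible bases). *)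

theory Defs
  imports "HOL-Analysis.Analysis" "HOL-Algebra.Coset"
begin

text \<open>
  A complex torus of dimension 2 is \<open>\<complex>\<^sup>2 / L\<close> for a lattice \<open>L\<close>; it is an abelian surface if it admits
  a polarization (a positive definite Hermitian form whose imaginary part is integral on \<open>L\<close>).
  Throughout, a torus is given by its lattice \<open>L \<subseteq> \<complex>\<^sup>2\<close>.
\<close>

type_synonym cspace = "complex^2"

definition lattice_basis :: "cspace set \<Rightarrow> (4 \<Rightarrow> cspace) \<Rightarrow> bool" where
  "lattice_basis L b \<longleftrightarrow> inj b \<and> independent (range b) \<and>
     L = {(\<Sum>i\<in>UNIV. of_int (n i) *\<^sub>R b i) | n :: 4 \<Rightarrow> int. True}"

definition is_lattice :: "cspace set \<Rightarrow> bool" where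
  "is_lattice L \<longleftrightarrow> (\<exists>b. lattice_basis L b)"

definition clinear_map :: "(cspace \<Rightarrow> cspace) \<Rightarrow> bool" where
  "clinear_map F \<longleftrightarrow> linear F \<and> (\<forall>c v. F (c *s v) = c *s F v)"

definition polarization :: "cspace set \<Rightarrow> (cspace \<Rightarrow> cspace \<Rightarrow> complex) \<Rightarrow> bool" where
  "polarization L H \<longleftrightarrow>
     (\<forall>u u' v. H (u + u') v = H u v + H u' v) \<and>
     (\<forall>c u v. H (c *s u) v = c * H u v) \<and>
     (\<forall>u v. H v u = cnj (H u v)) \<and>
     (\<forall>u. u \<noteq> 0 \<longrightarrow> 0 < Re (H u u)) \<and>
     (\<forall>x\<in>L. \<forall>y\<in>L. Im (H x y) \<in> \<int>)"

definition abelian_surface :: "cspace set \<Rightarrow> bool" where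
  "abelian_surface L \<longleftrightarrow> is_lattice L \<and> (\<exists>H. polarization L H)"


section \<open>Homomorphisms and isogenies\<close>

definition cspace_group :: "cspace monoid" where
  "cspace_group = \<lparr>carrier = UNIV, mult = (+), one = 0\<rparr>"

definition torus :: "cspace set \<Rightarrow> cspace set monoid" where
  "torus L = cspace_group Mod L"

definition torus_proj :: "cspace set \<Rightarrow> cspace \<Rightarrow> cspace set" where
  "torus_proj L v = L #>\<^bsub>cspace_group\<^esub> v"

text \<open>The quotient map is the universal cover and a local biholomorphism, so a map of tori is
  holomorphic iff it locally lifts to a holomorphic map between open subsets of \<open>\<complex>\<^sup>2\<close>.\<close>

definition torus_holomorphic :: "cspace set \<Rightarrow> cspace set \<Rightarrow> (cspace set \<Rightarrow> cspace set) \<Rightarrow> bool" where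
  "torus_holomorphic L M f \<longleftrightarrow>
     (\<forall>v. \<exists>U g. open U \<and> v \<in> U \<and>
        (\<forall>u\<in>U. f (torus_proj L u) = torus_proj M (g u)) \<and>
        (\<forall>u\<in>U. \<exists>D. clinear_map D \<and> (g has_derivative D) (at u)))"

definition isogeny :: "cspace set \<Rightarrow> cspace set \<Rightarrow> (cspace set \<Rightarrow> cspace set) \<Rightarrow> bool" where
  "isogeny L M f \<longleftrightarrow>
     f \<in> hom (torus L) (torus M) \<and> torus_holomorphic L M f \<and>
     f ` carrier (torus L) = carrier (torus M) \<and>
     finite (kernel (torus L) (torus M) f)"

definition isogeny_degree :: "cspace set \<Rightarrow> cspace set \<Rightarrow> (cspace set \<Rightarrow> cspace set) \<Rightarrow> nat" where
  "isogeny_degree L M f = card (kernel (torus L) (torus M) f)"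

text \<open>The analytic representation: the unique \<open>\<complex>\<close>-linear lift of a homomorphism of complex tori
  to the universal covers (equivalently its differential at the origin).\<close>

definition analytic_rep :: "cspace set \<Rightarrow> cspace set \<Rightarrow> (cspace set \<Rightarrow> cspace set) \<Rightarrow> cspace \<Rightarrow> cspace" where
  "analytic_rep L M f =
     (THE F. clinear_map F \<and> (\<forall>v. f (torus_proj L v) = torus_proj M (F v)))"


section \<open>Cohomology\<close>

text \<open>
  Complex cohomology of \<open>\<complex>\<^sup>2 / L\<close> is represented by translation-invariant differential forms:
  \<open>H\<^sup>1\<close> is the space of \<open>\<real>\<close>-linear maps \<open>\<complex>\<^sup>2 \<rightarrow> \<complex>\<close>, and \<open>L\<close> is the first integral homology group, the
  pairing of a class with a loop being evaluation. So \<open>H\<^sup>1(X,\<rat>) = Hom(L,\<rat>)\<close> consists of the forms with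
  rational periods. Higher cohomology is the exterior algebra, realized by alternating forms;
  wedge products are sums over shuffles with no factorial in front.
\<close>

type_synonym form1 = "cspace \<Rightarrow> complex"
type_synonym form2 = "cspace \<Rightarrow> cspace \<Rightarrow> complex"
type_synonym form4 = "cspace \<Rightarrow> cspace \<Rightarrow> cspace \<Rightarrow> cspace \<Rightarrow> complex"

definition wedge11 :: "form1 \<Rightarrow> form1 \<Rightarrow> form2" where
  "wedge11 \<phi> \<eta> = (\<lambda>u v. \<phi> u * \<eta> v - \<phi> v * \<eta> u)"

definition wedge22 :: "form2 \<Rightarrow> form2 \<Rightarrow> form4" where
  "wedge22 \<alpha> \<beta> = (\<lambda>a b c d.
       \<alpha> a b * \<beta> c d - \<alpha> a c * \<beta> b d + \<alpha> a d * \<beta> b c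
     + \<alpha> b c * \<beta> a d - \<alpha> b d * \<beta> a c + \<alpha> c d * \<beta> a b)"

text \<open>The image of \<open>A \<otimes> B\<close> in the second exterior power, for linear subspaces \<open>A\<close>, \<open>B\<close> of \<open>H\<^sup>1\<close>.\<close>

definition wedge_span :: "form1 set \<Rightarrow> form1 set \<Rightarrow> form2 set" where
  "wedge_span A B = {(\<lambda>u v. \<Sum>i<n. wedge11 (\<phi> i) (\<eta> i) u v) | (n::nat) \<phi> \<eta>.
     \<forall>i<n. \<phi> i \<in> A \<and> \<eta> i \<in> B}"

definition H1_rat :: "cspace set \<Rightarrow> form1 set" where
  "H1_rat L = {\<phi>. linear \<phi> \<and> (\<forall>x\<in>L. \<phi> x \<in> \<rat>)}"

definition H2_rat :: "cspace set \<Rightarrow> form2 set" where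
  "H2_rat L = wedge_span (H1_rat L) (H1_rat L)"

text \<open>The complex cohomology and its Hodge pieces do not depend on the lattice as sets of forms on
  \<open>\<complex>\<^sup>2\<close>; only the rational structure does.\<close>

definition H1_complex :: "form1 set" where
  "H1_complex = {\<phi>. linear \<phi>}"

definition H10 :: "form1 set" where
  "H10 = {\<phi>\<in>H1_complex. \<forall>c v. \<phi> (c *s v) = c * \<phi> v}"

definition H01 :: "form1 set" where
  "H01 = {\<phi>\<in>H1_complex. \<forall>c v. \<phi> (c *s v) = cnj c * \<phi> v}"

definition H2_complex :: "form2 set" where
  "H2_complex = wedge_span H1_complex H1_complex"

definition H20 :: "form2 set" where "H20 = wedge_span H10 H10"
definition H11 :: "form2 set" where "H11 = wedge_span H10 H01"
definition H02 :: "form2 set" where "H02 = wedge_span H01 H01"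

text \<open>The form \<open>dx\<^sub>1 \<and> dy\<^sub>1 \<and> dx\<^sub>2 \<and> dy\<^sub>2\<close>, where \<open>z\<^sub>k = x\<^sub>k + i y\<^sub>k\<close>, defines the complex orientation.\<close>

definition volume_form :: form4 where
  "volume_form =
     wedge22 (wedge11 (\<lambda>v. of_real (Re (v $ 1))) (\<lambda>v. of_real (Im (v $ 1))))
             (wedge11 (\<lambda>v. of_real (Re (v $ 2))) (\<lambda>v. of_real (Im (v $ 2))))"

definition oriented_lattice_basis :: "cspace set \<Rightarrow> (4 \<Rightarrow> cspace) \<Rightarrow> bool" where
  "oriented_lattice_basis L b \<longleftrightarrow>
     lattice_basis L b \<and> 0 < Re (volume_form (b 1) (b 2) (b 3) (b 4))"

text \<open>The trace is integration over \<open>\<complex>\<^sup>2 / L\<close>. For an invariant form this is evaluation on any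
  positively oriented lattice basis: two such bases differ by a matrix in \<open>SL\<^sub>4(\<int>)\<close>.\<close>

definition torus_trace :: "cspace set \<Rightarrow> form4 \<Rightarrow> complex" where
  "torus_trace L \<omega> =
     (let b = (SOME b. oriented_lattice_basis L b) in \<omega> (b 1) (b 2) (b 3) (b 4))"

definition H2_pairing :: "cspace set \<Rightarrow> form2 \<Rightarrow> form2 \<Rightarrow> complex" where
  "H2_pairing L \<alpha> \<beta> = torus_trace L (wedge22 \<alpha> \<beta>)"

definition H2_pullback :: "cspace set \<Rightarrow> cspace set \<Rightarrow> (cspace set \<Rightarrow> cspace set) \<Rightarrow> form2 \<Rightarrow> form2" where
  "H2_pullback L M f \<alpha> = (\<lambda>u v. \<alpha> (analytic_rep L M f u) (analytic_rep L M f v))"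


section \<open>Admissible Hodge isometries\<close>

definition complexification :: "cspace set \<Rightarrow> (form2 \<Rightarrow> form2) \<Rightarrow> (form2 \<Rightarrow> form2) \<Rightarrow> bool" where
  "complexification L \<psi> \<Psi> \<longleftrightarrow>
     (\<forall>\<alpha>\<in>H2_complex. \<Psi> \<alpha> \<in> H2_complex) \<and>
     (\<forall>\<alpha>\<in>H2_complex. \<forall>\<beta>\<in>H2_complex. \<Psi> (\<lambda>u v. \<alpha> u v + \<beta> u v) = (\<lambda>u v. \<Psi> \<alpha> u v + \<Psi> \<beta> u v)) \<and>
     (\<forall>c. \<forall>\<alpha>\<in>H2_complex. \<Psi> (\<lambda>u v. c * \<alpha> u v) = (\<lambda>u v. c * \<Psi> \<alpha> u v)) \<and>
     (\<forall>\<alpha>\<in>H2_rat L. \<Psi> \<alpha> = \<psi> \<alpha>)"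

definition hodge_isometry :: "cspace set \<Rightarrow> cspace set \<Rightarrow> (form2 \<Rightarrow> form2) \<Rightarrow> bool" where
  "hodge_isometry L M \<psi> \<longleftrightarrow>
     bij_betw \<psi> (H2_rat L) (H2_rat M) \<and>
     (\<forall>\<alpha>\<in>H2_rat L. \<forall>\<beta>\<in>H2_rat L. \<psi> (\<lambda>u v. \<alpha> u v + \<beta> u v) = (\<lambda>u v. \<psi> \<alpha> u v + \<psi> \<beta> u v)) \<and>
     (\<forall>q::rat. \<forall>\<alpha>\<in>H2_rat L. \<psi> (\<lambda>u v. of_rat q * \<alpha> u v) = (\<lambda>u v. of_rat q * \<psi> \<alpha> u v)) \<and>
     (\<exists>\<Psi>. complexification L \<psi> \<Psi> \<and> \<Psi> ` H20 = H20 \<and> \<Psi> ` H11 = H11 \<and> \<Psi> ` H02 = H02) \<and>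
     (\<forall>\<alpha>\<in>H2_rat L. \<forall>\<beta>\<in>H2_rat L. H2_pairing M (\<psi> \<alpha>) (\<psi> \<beta>) = H2_pairing L \<alpha> \<beta>)"

definition H1_basis :: "cspace set \<Rightarrow> (4 \<Rightarrow> form1) \<Rightarrow> bool" where
  "H1_basis L v \<longleftrightarrow> (\<forall>i. v i \<in> H1_rat L) \<and>
     (\<forall>\<phi>\<in>H1_rat L. \<exists>!c :: 4 \<Rightarrow> rat. \<phi> = (\<lambda>u. \<Sum>i\<in>UNIV. of_rat (c i) * v i u))"

definition admissible_basis :: "cspace set \<Rightarrow> (4 \<Rightarrow> form1) \<Rightarrow> bool" where
  "admissible_basis L v \<longleftrightarrow> H1_basis L v \<and>
     torus_trace L (wedge22 (wedge11 (v 1) (v 2)) (wedge11 (v 3) (v 4))) = 1"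

definition associated_basis :: "(4 \<Rightarrow> form1) \<Rightarrow> 6 \<Rightarrow> form2" where
  "associated_basis v k =
     (if k = 1 then wedge11 (v 1) (v 2)
      else if k = 2 then wedge11 (v 1) (v 3)
      else if k = 3 then wedge11 (v 1) (v 4)
      else if k = 4 then wedge11 (v 2) (v 3)
      else if k = 5 then wedge11 (v 2) (v 4)
      else wedge11 (v 3) (v 4))"

definition matrix_wrt :: "(6 \<Rightarrow> form2) \<Rightarrow> (6 \<Rightarrow> form2) \<Rightarrow> (form2 \<Rightarrow> form2) \<Rightarrow> rat^6^6 \<Rightarrow> bool" where
  "matrix_wrt B C \<psi> A \<longleftrightarrow>
     (\<forall>k. \<psi> (B k) = (\<lambda>u v. \<Sum>l\<in>UNIV. of_rat (A $ l $ k) * C l u v))"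

text \<open>Admissible bases exist and the determinant does not depend on them, so asking for one pair of
  admissible bases is the same as asking for all pairs.\<close>

definition admissible_isometry :: "cspace set \<Rightarrow> cspace set \<Rightarrow> (form2 \<Rightarrow> form2) \<Rightarrow> bool" where
  "admissible_isometry L M \<psi> \<longleftrightarrow>
     hodge_isometry L M \<psi> \<and>
     (\<exists>v w A. admissible_basis L v \<and> admissible_basis M w \<and>
        matrix_wrt (associated_basis v) (associated_basis w) \<psi> A \<and> det A = 1)"

end

theory Submission
  imports Defs
begin

text \<open>
  Identify \<open>H\<^sup>2\<close> with the skew \<open>4 \<times> 4\<close> matrices, the pairing being the polarization of the Pfaffian.
  By the Cartan-Dieudonne argument a rational isometry is a product of reflections, and an even
  product when its determinant is 1. The reflection in \<open>a\<close> is, up to a scalar, \<open>S \<mapsto> a S\<^sup>* a\<^sup>T\<close> with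
  \<open>S\<^sup>*\<close> the Hodge dual of \<open>S\<close>, so an even product has the form \<open>S \<mapsto> G S G\<^sup>T / l\<close> with \<open>det G = l\<^sup>2\<close>.
  After clearing denominators \<open>G\<close> becomes a real linear map \<open>F\<close> of \<open>\<complex>\<^sup>2\<close> carrying one lattice into the
  other, and the index of the image is the determinant \<open>d\<^sup>2\<close>. Finally \<open>F\<close> is complex linear: pulling
  back the holomorphic symplectic form \<open>dz\<^sub>1 \<and> dz\<^sub>2\<close> gives a complex bilinear form, because the
  isometry preserves the (2,0)-part of the Hodge decomposition, and \<open>dz\<^sub>1 \<and> dz\<^sub>2\<close> is nondegenerate.
\<close>

section \<open>Linear algebra in dimensions four and six\<close>

lemma exhaust_6:
  fixes x :: 6
  shows "x = 1 \<or> x = 2 \<or> x = 3 \<or> x = 4 \<or> x = 5 \<or> x = 6"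
proof (induct x)
  case (of_int z)
  then have "z = 0 \<or> z = 1 \<or> z = 2 \<or> z = 3 \<or> z = 4 \<or> z = 5" by auto
  then show ?case by auto
qed

lemma UNIV_6: "UNIV = {1, 2, 3, 4, 5, 6::6}"
  using exhaust_6 by auto

lemma forall_6: "(\<forall>i::6. P i) \<longleftrightarrow> P 1 \<and> P 2 \<and> P 3 \<and> P 4 \<and> P 5 \<and> P 6"
  by (metis exhaust_6)

lemma sum_6: "sum f (UNIV::6 set) = f 1 + f 2 + f 3 + f 4 + f 5 + f 6"
  unfolding UNIV_6 by (simp add: ac_simps)

lemma det_4:
  "det (A::'a::comm_ring_1^4^4) =
    A$1$1 * (A$2$2 * (A$3$3 * A$4$4)) - A$1$1 * (A$2$2 * (A$3$4 * A$4$3)) +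
    (A$1$1 * (A$2$3 * (A$3$4 * A$4$2)) - A$1$1 * (A$2$3 * (A$3$2 * A$4$4)) +
     (A$1$1 * (A$2$4 * (A$3$2 * A$4$3)) - A$1$1 * (A$2$4 * (A$3$3 * A$4$2)))) +
    (A$1$2 * (A$2$1 * (A$3$4 * A$4$3)) - A$1$2 * (A$2$1 * (A$3$3 * A$4$4)) +
     (A$1$2 * (A$2$3 * (A$3$1 * A$4$4)) - A$1$2 * (A$2$3 * (A$3$4 * A$4$1)) +
      (A$1$2 * (A$2$4 * (A$3$3 * A$4$1)) - A$1$2 * (A$2$4 * (A$3$1 * A$4$3)))) +
     (A$1$3 * (A$2$2 * (A$3$4 * A$4$1)) - A$1$3 * (A$2$2 * (A$3$1 * A$4$4)) +
      (A$1$3 * (A$2$1 * (A$3$2 * A$4$4)) - A$1$3 * (A$2$1 * (A$3$4 * A$4$2)) +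
       (A$1$3 * (A$2$4 * (A$3$1 * A$4$2)) - A$1$3 * (A$2$4 * (A$3$2 * A$4$1)))) +
      (A$1$4 * (A$2$2 * (A$3$1 * A$4$3)) - A$1$4 * (A$2$2 * (A$3$3 * A$4$1)) +
       (A$1$4 * (A$2$3 * (A$3$2 * A$4$1)) - A$1$4 * (A$2$3 * (A$3$1 * A$4$2)) +
        (A$1$4 * (A$2$1 * (A$3$3 * A$4$2)) - A$1$4 * (A$2$1 * (A$3$2 * A$4$3)))))))"
    (is "_ = ?rhs")
proof -
  have f: "finite {2::4, 3, 4}" "1 \<notin> {2::4, 3, 4}" "finite {3::4, 4}" "2 \<notin> {3::4, 4}"
    "finite {4::4}" "3 \<notin> {4::4}"
    by auto
  \<comment> \<open>With \<open>P\<close> opaque the simplifier only expands the determinant and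
    meets no equation to rearrange; afterwards \<open>P\<close> is taken to be equality with
    \<open>det A\<close>.\<close>
  have "P (det A) \<Longrightarrow> P ?rhs" for P
    unfolding det_def UNIV_4
    unfolding sum_over_permutations_insert[OF f(1,2)]
    unfolding sum_over_permutations_insert[OF f(3,4)]
    unfolding sum_over_permutations_insert[OF f(5,6)]
    unfolding permutes_sing
    by (simp add: sign_swap_id permutation_swap_id permutation_compose sign_compose sign_id)
  from this[of "(=) (det A)", OF refl] show ?thesis .
qed

text \<open>The matrix determinant lemma for \<open>1 - u w^T\<close>. If \<open>R\<close> is the
  identity with row \<open>k\<close> replaced by \<open>w\<close>, then
  \<open>w^T = e_k^T R\<close>, hence \<open>R (1 - u w^T) = (1 - (R u) e_k^T) R\<close>. The new
  left factor \<open>C\<close> differs from the identity in column \<open>k\<close> only, so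
  Cramer's rule gives its determinant.\<close>

lemma det_rank_one_update:
  fixes u w :: "'a::field^'n"
  shows "det (\<chi> i j. (if i = j then 1 else 0) - u$i * w$j) = 1 - (\<Sum>i\<in>UNIV. w$i * u$i)"
    (is "det ?M = _")
proof (cases "w = 0")
  case True
  then have "?M = mat 1" by (simp add: vec_eq_iff mat_def)
  with True show ?thesis by simp
next
  case False
  then obtain k where k: "w$k \<noteq> 0" by (auto simp: vec_eq_iff)
  define R :: "'a^'n^'n" where "R = (\<chi> i j. if i = k then w$j else if i = j then 1 else 0)"
  have detR: "det R = w$k"
  proof -
    have "det (transpose R) = det (\<chi> i j. if j = k then (mat 1 *v w)$i else (mat 1::'a^'n^'n)$i$j)"
      unfolding matrix_vector_mul_lid
      by (rule arg_cong[where f = det]) (auto simp: R_def transpose_def vec_eq_iff mat_def)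
    also have "\<dots> = w$k" by (simp only: cramer_lemma det_I mult_1_right)
    finally show ?thesis by simp
  qed
  define C :: "'a^'n^'n" where
    "C = (\<chi> i j. if j = k then (mat 1 *v (axis k 1 - R *v u))$i else (mat 1::'a^'n^'n)$i$j)"
  have detC: "det C = 1 - (\<Sum>i\<in>UNIV. w$i * u$i)"
    unfolding C_def cramer_lemma by (simp add: R_def matrix_vector_mult_def)
  have "R ** ?M = C ** R"
  proof -
    have L: "(R ** ?M) $ i $ j = R$i$j - (R *v u)$i * w$j" for i j
      by (simp add: matrix_matrix_mult_def matrix_vector_mult_def sum_subtractf right_diff_distrib
          sum_distrib_right mult_delta_right mult.assoc)
    have C: "C $ i $ j = (if i = j then 1 else 0) - (R *v u)$i * (if j = k then 1 else 0)" for i j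
      unfolding C_def matrix_vector_mul_lid by (auto simp: mat_def axis_def)
    have "(C ** R) $ i $ j = R$i$j - (R *v u)$i * R$k$j" for i j
      unfolding matrix_matrix_mult_def
      by (simp add: C left_diff_distrib sum_subtractf mult_delta_left mult_delta_right)
    moreover have "R$k$j = w$j" for j by (simp add: R_def)
    ultimately show ?thesis by (simp add: L vec_eq_iff)
  qed
  then have "det R * det ?M = det R * det C"
    by (simp only: det_mul [symmetric]) (simp only: det_mul mult.commute)
  with k show ?thesis unfolding detR detC by (simp only: mult_cancel_left simp_thms)
qed

section \<open>Skew matrices and reflections in the Plucker quadric\<close>

lemma vector_4 [simp]:
  "(vector [a, b, c, d] :: 'a::zero^4) $ 1 = a"
  "(vector [a, b, c, d] :: 'a::zero^4) $ 2 = b"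
  "(vector [a, b, c, d] :: 'a::zero^4) $ 3 = c"
  "(vector [a, b, c, d] :: 'a::zero^4) $ 4 = d"
  unfolding vector_def by simp_all

lemma vector_6 [simp]:
  "(vector [a, b, c, d, e, f] :: 'a::zero^6) $ 1 = a"
  "(vector [a, b, c, d, e, f] :: 'a::zero^6) $ 2 = b"
  "(vector [a, b, c, d, e, f] :: 'a::zero^6) $ 3 = c"
  "(vector [a, b, c, d, e, f] :: 'a::zero^6) $ 4 = d"
  "(vector [a, b, c, d, e, f] :: 'a::zero^6) $ 5 = e"
  "(vector [a, b, c, d, e, f] :: 'a::zero^6) $ 6 = f"
  unfolding vector_def by simp_all

text \<open>Coordinates belong to the index pairs 12, 13, 14, 23, 24, 34 in this order, so this is
  the coefficient of \<open>e1 ^ e2 ^ e3 ^ e4\<close> in the wedge product of two bivectors.\<close>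

definition plucker :: "'a::comm_ring_1^6 \<Rightarrow> 'a^6 \<Rightarrow> 'a" where
  "plucker x y = x$1 * y$6 - x$2 * y$5 + x$3 * y$4 + x$4 * y$3 - x$5 * y$2 + x$6 * y$1"

definition pfaff :: "'a::comm_ring_1^6 \<Rightarrow> 'a" where
  "pfaff x = x$1 * x$6 - x$2 * x$5 + x$3 * x$4"

definition skew :: "'a::comm_ring_1^6 \<Rightarrow> 'a^4^4" where
  "skew x = vector [vector [0, x$1, x$2, x$3], vector [- x$1, 0, x$4, x$5],
                    vector [- x$2, - x$4, 0, x$6], vector [- x$3, - x$5, - x$6, 0]]"

text \<open>Complementary index pairs are exchanged with the sign of the shuffle. Equivalently, this
  is the Gram matrix of \<open>plucker\<close> applied to \<open>x\<close>.\<close>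

definition hodge :: "'a::comm_ring_1^6 \<Rightarrow> 'a^6" where
  "hodge x = vector [x$6, - x$5, x$4, x$3, - x$2, x$1]"

lemma plucker_self: "plucker x x = 2 * pfaff x"
  by (simp add: plucker_def pfaff_def algebra_simps)

lemma plucker_commute: "plucker x y = plucker y x"
  by (simp add: plucker_def algebra_simps)

lemma plucker_add: "plucker x (y + z) = plucker x y + plucker x z"
  by (simp add: plucker_def algebra_simps)

lemma plucker_diff: "plucker x (y - z) = plucker x y - plucker x z"
  by (simp add: plucker_def algebra_simps)

lemma plucker_scale: "plucker x (c *s y) = c * plucker x y"
  by (simp add: plucker_def algebra_simps)

lemma hodge_hodge [simp]: "hodge (hodge x) = x"
  by (simp add: hodge_def vec_eq_iff forall_6)

lemma pfaff_hodge [simp]: "pfaff (hodge x) = pfaff x"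
  by (simp add: hodge_def pfaff_def algebra_simps)

lemma det_skew: "det (skew x) = (pfaff x)\<^sup>2"
  unfolding det_4 by (simp add: skew_def pfaff_def power2_eq_square algebra_simps)

section \<open>Reflections and their determinants\<close>

definition reflect :: "'a::field^6 \<Rightarrow> 'a^6 \<Rightarrow> 'a^6" where
  "reflect a x = x - (plucker a x / pfaff a) *s a"

text \<open>After clearing the denominator in \<open>reflect\<close> both sides are polynomial, and
  the entries are compared directly. The dual has to appear: a reflection has determinant -1,
  whereas a congruence by \<open>G\<close> with \<open>det G = l^2\<close>, divided by
  \<open>l\<close>, acts on bivectors with determinant 1; \<open>hodge\<close> supplies the missing
  sign.\<close>

lemma skew_refl:
  assumes "pfaff a \<noteq> 0"
  shows "skew a ** skew (hodge x) ** transpose (skew a) = skew (- pfaff a *s reflect a x)"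
proof -
  have "- pfaff a *s reflect a x = plucker a x *s a - pfaff a *s x"
    using assms by (simp add: reflect_def vec_eq_iff right_diff_distrib)
  moreover have "skew a ** skew (hodge x) ** transpose (skew a)
      = skew (plucker a x *s a - pfaff a *s x)"
    by (simp add: skew_def hodge_def transpose_def plucker_def pfaff_def matrix_matrix_mult_def
        vec_eq_iff forall_4 sum_4 algebra_simps)
  ultimately show ?thesis by simp
qed

text \<open>The shape \<open>1 - u w^T\<close> makes \<open>det_rank_one_update\<close>
  applicable.\<close>

definition reflect_mat :: "'a::field^6 \<Rightarrow> 'a^6^6" where
  "reflect_mat a = (\<chi> i j. (if i = j then 1 else 0) - (inverse (pfaff a) *s a)$i * hodge a $ j)"

lemma plucker_hodge: "plucker a x = (\<Sum>j\<in>UNIV. hodge a $ j * x $ j)"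
  by (simp add: hodge_def plucker_def sum_6 algebra_simps)

lemma reflect_mat_mult: "reflect_mat a *v x = reflect a x"
proof -
  have "(reflect_mat a *v x) $ i = x $ i - inverse (pfaff a) * a $ i * plucker a x" for i
    unfolding plucker_hodge
    by (simp add: reflect_mat_def matrix_vector_mult_def left_diff_distrib sum_subtractf
        sum_distrib_left mult_delta_left mult.assoc)
  then show ?thesis by (simp add: reflect_def vec_eq_iff field_simps)
qed

lemma det_reflect_mat:
  assumes "pfaff a \<noteq> 0"
  shows "det (reflect_mat a) = - 1"
proof -
  have "(\<Sum>i\<in>UNIV. hodge a $ i * (inverse (pfaff a) *s a)$i) = inverse (pfaff a) * plucker a a"
    unfolding plucker_hodge sum_distrib_left by (simp add: mult_ac)
  with assms show ?thesis
    unfolding reflect_mat_def det_rank_one_update by (simp add: plucker_self)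
qed

text \<open>\<open>hodge\<close> is a linear isometry, so it carries the reflection in
  \<open>a\<close> to the reflection in \<open>hodge a\<close>.\<close>

lemma hodge_refl: "hodge (reflect a x) = reflect (hodge a) (hodge x)"
proof -
  have "plucker (hodge a) (hodge x) = plucker a x"
    by (simp add: plucker_def hodge_def algebra_simps)
  then show ?thesis
    unfolding reflect_def pfaff_hodge by (simp add: hodge_def vec_eq_iff forall_6)
qed

lemma refl_scale: "reflect a (c *s x) = c *s reflect a x"
  by (simp add: reflect_def plucker_scale vec_eq_iff algebra_simps)

lemma refl_isometry:
  assumes "pfaff a \<noteq> 0"
  shows "plucker (reflect a x) (reflect a y) = plucker x y"
proof -
  have "plucker a a / pfaff a = 2" using assms by (simp add: plucker_self)
  moreover have "plucker (reflect a x) (reflect a y) = plucker x y - 2 * (plucker a x * plucker a y / pfaff a)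
      + plucker a x * plucker a y / pfaff a * (plucker a a / pfaff a)"
    unfolding reflect_def plucker_diff plucker_scale plucker_commute[of "x - _"] plucker_commute[of x a]
      plucker_commute[of y]
    unfolding plucker_diff plucker_scale plucker_commute[of y a] plucker_commute[of y x]
    by (simp add: algebra_simps)
  ultimately show ?thesis by simp
qed

lemma refl_orthogonal: "plucker a x = 0 \<Longrightarrow> reflect a x = x"
  by (simp add: reflect_def)

lemma refl_self: "pfaff a \<noteq> 0 \<Longrightarrow> reflect a a = - a"
  by (simp add: reflect_def plucker_self vec_eq_iff)

lemma refl_refl: "pfaff a \<noteq> 0 \<Longrightarrow> reflect a (reflect a x) = x"
  by (simp add: reflect_def plucker_self vec_eq_iff plucker_diff plucker_scale)

text \<open>Equal norms give \<open>plucker (y - x) y = pfaff (y - x)\<close>, so the reflection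
  subtracts exactly \<open>y - x\<close> from \<open>y\<close>.\<close>

lemma refl_diff_swap:
  fixes x y :: "'a::field_char_0^6"
  assumes "plucker x x = plucker y y" "pfaff (y - x) \<noteq> 0"
  shows "reflect (y - x) y = x"
proof -
  have "2 * pfaff (y - x) = plucker (y - x) (y - x)" by (simp add: plucker_self)
  also have "\<dots> = 2 * plucker (y - x) y"
    using assms(1) by (simp add: plucker_commute[of "y - x"] plucker_diff plucker_commute[of x y])
  finally show ?thesis using assms(2) by (simp add: reflect_def vec_eq_iff)
qed

section \<open>Products of reflections and their lifts to matrices of size four\<close>

text \<open>The flag is the parity of the number of factors, \<open>True\<close> for even; it is
  visible in the determinant.\<close>

inductive refl_prod :: "bool \<Rightarrow> 'a::field^6^6 \<Rightarrow> bool" where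
  "refl_prod True (mat 1)"
| "refl_prod p A \<Longrightarrow> pfaff a \<noteq> 0 \<Longrightarrow> refl_prod (\<not> p) (reflect_mat a ** A)"

lemma det_refl_prod: "refl_prod p A \<Longrightarrow> det A = (if p then 1 else - 1)"
  by (induction rule: refl_prod.induct) (auto simp: det_mul det_reflect_mat)

lemma refl_prod_cancel:
  assumes "refl_prod p (reflect_mat a ** A)" "pfaff a \<noteq> 0"
  shows "refl_prod (\<not> p) A"
proof -
  have "reflect_mat a ** (reflect_mat a ** A) = A"
    unfolding matrix_eq matrix_vector_mul_assoc [symmetric] reflect_mat_mult
    using assms(2) by (simp add: refl_refl)
  with refl_prod.intros(2)[OF assms] show ?thesis by simp
qed

text \<open>The induction must carry a lift \<open>G\<close> of \<open>A\<close> and a lift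
  \<open>H\<close> of its dual together. Since \<open>skew_refl\<close> consumes a dual,
  \<open>skew a\<close> turns \<open>H\<close> into the next \<open>G\<close>, and
  \<open>skew (hodge a)\<close> turns \<open>G\<close> into the next \<open>H\<close>. Each factor
  also moves the dual from one side of the parity test to the other.\<close>

lemma refl_prod_skew:
  "refl_prod p A \<Longrightarrow> \<exists>G H l m. l \<noteq> 0 \<and> m \<noteq> 0 \<and> det G = l\<^sup>2 \<and> det H = m\<^sup>2 \<and>
     (\<forall>x. G ** skew (if p then x else hodge x) ** transpose G = skew (l *s (A *v x))) \<and>
     (\<forall>x. H ** skew (if p then hodge x else x) ** transpose H = skew (m *s hodge (A *v x)))"
proof (induction rule: refl_prod.induct)
  case 1
  show ?case
    by (intro exI[of _ "mat 1"] exI[of _ 1]) (simp add: transpose_mat)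
next
  case (2 p A a)
  then obtain G H l m where *: "l \<noteq> 0" "m \<noteq> 0" "det G = l\<^sup>2" "det H = m\<^sup>2"
    "\<And>x. G ** skew (if p then x else hodge x) ** transpose G = skew (l *s (A *v x))"
    "\<And>x. H ** skew (if p then hodge x else x) ** transpose H = skew (m *s hodge (A *v x))"
    by blast
  have conj: "(B ** C) ** D ** transpose (B ** C) = B ** (C ** D ** transpose C) ** transpose B"
    for B C D :: "'a^4^4"
    by (simp add: matrix_transpose_mul matrix_mul_assoc)
  have hs: "hodge (c *s x) = c *s hodge x" for c and x :: "'a^6"
    by (simp add: hodge_def vec_eq_iff forall_6)
  have 1: "skew a ** H ** skew (if \<not> p then x else hodge x) ** transpose (skew a ** H)
      = skew ((- pfaff a * m) *s (reflect_mat a ** A *v x))" for x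
  proof -
    have "skew a ** H ** skew (if \<not> p then x else hodge x) ** transpose (skew a ** H)
      = skew a ** skew (hodge (m *s (A *v x))) ** transpose (skew a)"
      unfolding conj hs using *(6)[of x] by (cases p) simp_all
    also have "\<dots> = skew (- pfaff a *s reflect a (m *s (A *v x)))"
      by (rule skew_refl[OF 2(2)])
    finally show ?thesis
      by (simp add: refl_scale matrix_vector_mul_assoc [symmetric] reflect_mat_mult)
  qed
  have 2: "skew (hodge a) ** G ** skew (if \<not> p then hodge x else x) ** transpose (skew (hodge a) ** G)
      = skew ((- pfaff a * l) *s hodge (reflect_mat a ** A *v x))" for x
  proof -
    have "skew (hodge a) ** G ** skew (if \<not> p then hodge x else x) ** transpose (skew (hodge a) ** G)
      = skew (hodge a) ** skew (hodge (hodge (l *s (A *v x)))) ** transpose (skew (hodge a))"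
      unfolding conj hs using *(5)[of x] by (cases p) simp_all
    also have "\<dots> = skew (- pfaff (hodge a) *s reflect (hodge a) (hodge (l *s (A *v x))))"
      by (rule skew_refl) (simp add: 2(2))
    finally show ?thesis
      by (simp add: hodge_refl [symmetric] refl_scale hs matrix_vector_mul_assoc [symmetric] reflect_mat_mult)
  qed
  show ?case
    by (rule exI[of _ "skew a ** H"], rule exI[of _ "skew (hodge a) ** G"],
        rule exI[of _ "- pfaff a * m"], rule exI[of _ "- pfaff a * l"])
      (use * \<open>pfaff a \<noteq> 0\<close> 1 2 in \<open>simp add: det_mul det_skew power_mult_distrib\<close>)
qed

section \<open>The Cartan-Dieudonne argument for the Plucker form\<close>

text \<open>The coordinate pairs 1 and 6, 2 and 5, 3 and 4 span three hyperbolic planes. Sums and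
  differences within each pair give, in characteristic zero, an orthogonal basis of anisotropic
  vectors.\<close>

definition hyp_basis :: "nat \<Rightarrow> 'a::field^6" where
  "hyp_basis k = [vector [1, 0, 0, 0, 0, 1], vector [1, 0, 0, 0, 0, - 1],
     vector [0, 1, 0, 0, 1, 0], vector [0, 1, 0, 0, - 1, 0],
     vector [0, 0, 1, 1, 0, 0], vector [0, 0, 1, - 1, 0, 0]] ! k"

lemma less_6: "(k::nat) < 6 \<longleftrightarrow> k = 0 \<or> k = 1 \<or> k = 2 \<or> k = 3 \<or> k = 4 \<or> k = 5"
  by auto

lemma hyp_basis_orthogonal:
  "i < 6 \<Longrightarrow> j < 6 \<Longrightarrow> i \<noteq> j \<Longrightarrow> plucker (hyp_basis i) (hyp_basis j) = 0"
  unfolding less_6 by (elim disjE) (simp_all add: hyp_basis_def plucker_def)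

lemma pfaff_hyp_basis: "i < 6 \<Longrightarrow> pfaff (hyp_basis i) \<noteq> 0"
  unfolding less_6 by (elim disjE) (simp_all add: hyp_basis_def pfaff_def)

lemma fix_hyp_basis:
  fixes A :: "'a::field_char_0^6^6"
  assumes "\<And>i. i < 6 \<Longrightarrow> A *v hyp_basis i = hyp_basis i"
  shows "A = mat 1"
  unfolding matrix_eq
proof
  fix x :: "'a^6"
  have x: "x = ((x$1 + x$6) / 2) *s hyp_basis 0 + ((x$1 - x$6) / 2) *s hyp_basis 1
    + ((x$2 + x$5) / 2) *s hyp_basis 2 + ((x$2 - x$5) / 2) *s hyp_basis 3
    + ((x$3 + x$4) / 2) *s hyp_basis 4 + ((x$3 - x$4) / 2) *s hyp_basis 5"
    by (simp add: hyp_basis_def vec_eq_iff forall_6 field_simps)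
  have "A *v x = x"
    by (subst (1 2) x, simp only: matrix_vector_right_distrib vector_scalar_commute)
      (simp add: assms)
  then show "A *v x = mat 1 *v x" by simp
qed

definition plucker_isometry :: "'a::field^6^6 \<Rightarrow> bool" where
  "plucker_isometry A \<longleftrightarrow> (\<forall>x y. plucker (A *v x) (A *v y) = plucker x y)"

lemma plucker_isometry_refl:
  "plucker_isometry A \<Longrightarrow> pfaff a \<noteq> 0 \<Longrightarrow> plucker_isometry (reflect_mat a ** A)"
  by (simp add: plucker_isometry_def matrix_vector_mul_assoc [symmetric] reflect_mat_mult refl_isometry)

text \<open>Induction on the number of basis vectors not yet known to be fixed. One or two
  reflections bring the image of the next basis vector back to it without moving the earlier ones;
  an isometry fixing all six vectors is the identity.\<close>

lemma refl_prod_of_isometry_fixing: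
  fixes A :: "'a::field_char_0^6^6"
  assumes "plucker_isometry A" "k \<le> 6" "\<And>i. i < k \<Longrightarrow> A *v hyp_basis i = hyp_basis i"
  shows "\<exists>p. refl_prod p A"
  using assms
proof (induction "6 - k" arbitrary: k A)
  case 0
  then have "A = mat 1" by (intro fix_hyp_basis) auto
  then show ?case using refl_prod.intros(1) by blast
next
  case (Suc n)
  then have k: "k < 6" by simp
  let ?x = "hyp_basis k :: 'a^6"
  let ?y = "A *v ?x"
  have yy: "plucker ?y ?y = plucker ?x ?x" using Suc by (simp add: plucker_isometry_def)
  have ox: "plucker ?x (hyp_basis i) = 0" if "i < k" for i
    using hyp_basis_orthogonal[of k i] k that by simp
  \<comment> \<open>Earlier basis vectors are their own images, so orthogonality to \<open>x\<close>
    passes to \<open>y\<close>. Reflections in combinations of \<open>x\<close> and \<open>y\<close>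
    therefore leave them fixed.\<close>
  have oy: "plucker ?y (hyp_basis i) = 0" if "i < k" for i
    using Suc(3) Suc(5)[OF that] ox[OF that] by (metis plucker_isometry_def)
  have step: "\<exists>p. refl_prod p B"
    if "plucker_isometry B" "B *v ?x = ?x" "\<And>i. i < k \<Longrightarrow> B *v hyp_basis i = hyp_basis i" for B
  proof (rule Suc(1)[of "Suc k" B])
    show "B *v hyp_basis i = hyp_basis i" if "i < Suc k" for i
      using that \<open>B *v ?x = ?x\<close> \<open>\<And>i. i < k \<Longrightarrow> B *v hyp_basis i = hyp_basis i\<close>
      by (auto simp: less_Suc_eq)
  qed (use Suc k that in auto)
  txt \<open>By this parallelogram law one of \<open>y - x\<close> and \<open>y + x\<close> is anisotropic.\<close>
  have parallelogram: "pfaff (?y - ?x) + pfaff (?y + ?x) = plucker ?y ?y + plucker ?x ?x"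
    by (simp add: pfaff_def plucker_def algebra_simps)
  have "plucker ?y ?y + plucker ?x ?x \<noteq> 0"
    using pfaff_hyp_basis[OF k, where 'a = 'a] unfolding yy by (simp add: plucker_self)
  then consider "pfaff (?y - ?x) \<noteq> 0" | "pfaff (?y + ?x) \<noteq> 0"
    using parallelogram by force
  then show ?case
  proof cases
    case 1
    let ?B = "reflect_mat (?y - ?x) ** A"
    have "\<exists>p. refl_prod p ?B"
    proof (rule step)
      show "plucker_isometry ?B" using Suc 1 by (intro plucker_isometry_refl)
      show "?B *v ?x = ?x"
        unfolding matrix_vector_mul_assoc [symmetric] reflect_mat_mult
        using refl_diff_swap[OF yy [symmetric] 1] .
      show "?B *v hyp_basis i = hyp_basis i" if "i < k" for i
        unfolding matrix_vector_mul_assoc [symmetric] reflect_mat_mult Suc(5)[OF that]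
        by (rule refl_orthogonal)
          (simp add: plucker_commute[of "?y - ?x"] plucker_diff plucker_commute[of "hyp_basis i"] ox oy that)
    qed
    then show ?thesis using refl_prod_cancel 1 by blast
  next
    case 2
    \<comment> \<open>The vector \<open>y - x\<close> may be isotropic here. Reflecting in
      \<open>y + x = y - (- x)\<close> sends \<open>y\<close> to \<open>- x\<close>, and the
      reflection in \<open>x\<close> repairs the sign.\<close>
    let ?B = "reflect_mat ?x ** (reflect_mat (?y + ?x) ** A)"
    have x: "pfaff ?x \<noteq> 0" using pfaff_hyp_basis k by blast
    have "\<exists>p. refl_prod p ?B"
    proof (rule step)
      show "plucker_isometry ?B" using Suc 2 x by (intro plucker_isometry_refl)
      have mm: "plucker (- ?x) (- ?x) = plucker ?x ?x" by (simp add: plucker_def)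
      have "reflect (?y - - ?x) ?y = - ?x"
        by (rule refl_diff_swap) (use 2 yy mm in simp_all)
      then show "?B *v ?x = ?x"
        unfolding matrix_vector_mul_assoc [symmetric] reflect_mat_mult
        using refl_refl[OF x, of ?x] refl_self[OF x] by simp
      show "?B *v hyp_basis i = hyp_basis i" if "i < k" for i
      proof -
        have "reflect (?y + ?x) (hyp_basis i) = hyp_basis i"
          by (rule refl_orthogonal)
            (simp add: plucker_commute[of "?y + ?x"] plucker_add plucker_commute[of "hyp_basis i"] ox oy that)
        then show ?thesis
          unfolding matrix_vector_mul_assoc [symmetric] reflect_mat_mult Suc(5)[OF that]
          using refl_orthogonal[OF ox[OF that]] by simp
      qed
    qed
    then show ?thesis using refl_prod_cancel 2 x by metis
  qed
qed

text \<open>Determinant 1 forces an even number of reflections, for which the dual no longer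
  appears. This is the exceptional map from four by four matrices to isometries of bivectors; the
  scalar \<open>l\<close> makes every isometry of determinant 1 reachable over the given
  field.\<close>

theorem isometry_lifts:
  fixes A :: "'a::field_char_0^6^6"
  assumes "plucker_isometry A" "det A = 1"
  shows "\<exists>G l. l \<noteq> 0 \<and> det G = l\<^sup>2 \<and> (\<forall>x. G ** skew x ** transpose G = skew (l *s (A *v x)))"
proof -
  obtain p where p: "refl_prod p A"
    using refl_prod_of_isometry_fixing[OF assms(1), of 0] by auto
  have "p" using det_refl_prod[OF p] assms(2) by (auto split: if_splits)
  then show ?thesis using refl_prod_skew[OF p] by auto
qed

section \<open>Counting lattice points in a fundamental domain\<close>

definition int_vec :: "real^'n \<Rightarrow> bool" where
  "int_vec x \<longleftrightarrow> (\<forall>i. x$i \<in> \<int>)"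

definition unit_cube :: "(real^'n) set" where
  "unit_cube = {x. \<forall>i. 0 \<le> x$i \<and> x$i < 1}"

lemma int_vec_diff: "int_vec x \<Longrightarrow> int_vec y \<Longrightarrow> int_vec (x - y)"
  and int_vec_add: "int_vec x \<Longrightarrow> int_vec y \<Longrightarrow> int_vec (x + y)"
  by (auto simp: int_vec_def)

lemma int_vec_mult:
  assumes "\<And>i j. N$i$j \<in> \<int>" "int_vec x"
  shows "int_vec (N *v x)"
  using assms by (auto simp: int_vec_def matrix_vector_mult_def intro!: Ints_sum Ints_mult)

definition frac_vec :: "real^'n \<Rightarrow> real^'n" where
  "frac_vec x = (\<chi> i. frac (x$i))"

lemma frac_vec_in_cube: "frac_vec x \<in> unit_cube"
  by (simp add: frac_vec_def unit_cube_def frac_ge_0 frac_lt_1)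

lemma int_vec_frac_vec: "int_vec (x - frac_vec x)"
  by (simp add: int_vec_def frac_vec_def frac_def)

lemma unit_cube_unique:
  assumes "x \<in> unit_cube" "y \<in> unit_cube" "int_vec (x - y)"
  shows "x = y"
proof -
  have "x$i = y$i" for i
  proof -
    obtain k where k: "x$i - y$i = of_int k"
      using assms(3) by (auto simp: int_vec_def elim: Ints_cases)
    have "0 \<le> x$i" "x$i < 1" "0 \<le> y$i" "y$i < 1"
      using assms(1,2) by (auto simp: unit_cube_def)
    with k have "\<bar>real_of_int k\<bar> < 1" by linarith
    then have "k = 0" by linarith
    with k show ?thesis by simp
  qed
  then show ?thesis by (simp add: vec_eq_iff)
qed

lemma finite_bounded_int_vec: "finite {x::real^'n. int_vec x \<and> (\<forall>i. \<bar>x$i\<bar> \<le> M)}"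
proof (rule finite_subset)
  show "{x::real^'n. int_vec x \<and> (\<forall>i. \<bar>x$i\<bar> \<le> M)} \<subseteq>
      (\<lambda>f. \<chi> i. real_of_int (f i)) ` (Pi\<^sub>E UNIV (\<lambda>_. {- \<lceil>M\<rceil>..\<lceil>M\<rceil>}))"
  proof
    fix x :: "real^'n" assume x: "x \<in> {x. int_vec x \<and> (\<forall>i. \<bar>x$i\<bar> \<le> M)}"
    have fl: "real_of_int \<lfloor>x$i\<rfloor> = x$i" for i
      using x by (auto simp: int_vec_def)
    have "\<bar>x$i\<bar> \<le> M" for i using x by auto
    then have "\<lfloor>x$i\<rfloor> \<in> {- \<lceil>M\<rceil>..\<lceil>M\<rceil>}" for i
      using fl[of i] by (smt (verit) atLeastAtMost_iff le_of_int_ceiling of_int_le_iff of_int_minus)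
    then show "x \<in> (\<lambda>f. \<chi> i. real_of_int (f i)) ` (Pi\<^sub>E UNIV (\<lambda>_. {- \<lceil>M\<rceil>..\<lceil>M\<rceil>}))"
      by (intro image_eqI[of _ _ "\<lambda>i. \<lfloor>x$i\<rfloor>"]) (auto simp: fl vec_eq_iff)
  qed
qed (simp add: finite_PiE)

lemma unit_cube_measure:
  "(unit_cube :: (real^'n) set) \<in> lmeasurable" "measure lebesgue (unit_cube :: (real^'n) set) = 1"
proof -
  have sub: "unit_cube \<subseteq> cbox (0::real^'n) 1" "box (0::real^'n) 1 \<subseteq> unit_cube"
    by (auto simp: unit_cube_def mem_box_cart less_imp_le)
  have "unit_cube = (\<Inter>i. {x::real^'n. 0 \<le> x$i} \<inter> {x. x$i < 1})"
    by (auto simp: unit_cube_def)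
  moreover have "{x::real^'n. 0 \<le> x$i} \<inter> {x. x$i < 1} \<in> sets borel" for i
    by (intro sets.Int borel_closed borel_open closed_halfspace_component_ge_cart open_halfspace_component_lt_cart)
  moreover have "(\<Inter>i. {x::real^'n. 0 \<le> x$i} \<inter> {x. x$i < 1}) \<in> sets borel"
    by (intro sets.finite_INT calculation(2)) auto
  ultimately have "(unit_cube :: (real^'n) set) \<in> sets borel" by simp
  then have "(unit_cube :: (real^'n) set) \<in> sets lebesgue" by simp
  then show m: "(unit_cube :: (real^'n) set) \<in> lmeasurable"
    using sub(1) bounded_cbox bounded_subset bounded_set_imp_lmeasurable by blast
  have one: "measure lebesgue (cbox (0::real^'n) 1) = 1"
    by (subst measure_completion, simp, subst content_cbox_cart) (auto simp: interval_ne_empty_cart)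
  have box: "measure lebesgue (box (0::real^'n) 1) = measure lebesgue (cbox (0::real^'n) 1)"
    by (simp add: measure_lborel_box_eq measure_lborel_cbox_eq)
  show "measure lebesgue (unit_cube :: (real^'n) set) = 1"
  proof (rule antisym)
    show "measure lebesgue (unit_cube :: (real^'n) set) \<le> 1"
      using measure_mono_fmeasurable[OF sub(1), of lebesgue] m one by (simp add: fmeasurableD)
    have "measure lebesgue (box (0::real^'n) 1) \<le> measure lebesgue (unit_cube :: (real^'n) set)"
      using measure_mono_fmeasurable[OF sub(2), of lebesgue] m by simp
    then show "1 \<le> measure lebesgue (unit_cube :: (real^'n) set)"
      using one box by linarith
  qed
qed

text \<open>The integral translates of the cube \<open>D\<close> cut \<open>N D\<close> into pieces; moved back into \<open>D\<close>, they cover every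
  point of \<open>D\<close> equally often.\<close>

lemma card_cube_lattice_points:
  fixes N :: "(real^('n::{finite,wellorder}))^('n::{finite,wellorder})"
  assumes int: "\<And>i j. N$i$j \<in> \<int>" and det: "det N \<noteq> 0"
  shows "finite {c \<in> unit_cube. int_vec (N *v c)}"
    and "real (card {c \<in> unit_cube. int_vec (N *v c)}) = \<bar>det N\<bar>"
proof -
  let ?D = "unit_cube :: ((real, 'n) vec) set"
  let ?S = "{c \<in> ?D. int_vec (N *v c)}"
  have "invertible N" using det by (simp add: invertible_det_nz)
  then obtain N' where N': "N ** N' = mat 1" "N' ** N = mat 1" by (auto simp: invertible_def)
  have NN': "N *v (N' *v x) = x" "N' *v (N *v x) = x" for x
    by (simp_all add: matrix_vector_mul_assoc N')
  \<comment> \<open>The summand 1 leaves room for subtracting a vector of the unit cube from a point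
    of its image under \<open>N\<close>.\<close>
  define M where "M = (\<Sum>i\<in>UNIV. \<Sum>j\<in>UNIV. \<bar>N$i$j\<bar>) + 1"
  have bd: "\<bar>(N *v c)$i\<bar> \<le> M - 1" if "c \<in> ?D" for c i
  proof -
    have "\<bar>(N *v c)$i\<bar> \<le> (\<Sum>j\<in>UNIV. \<bar>N$i$j * c$j\<bar>)"
      unfolding matrix_vector_mult_def by simp
    also have "\<dots> \<le> (\<Sum>j\<in>UNIV. \<bar>N$i$j\<bar>)"
    proof (rule sum_mono)
      fix j
      have "\<bar>c$j\<bar> \<le> 1" using that unfolding unit_cube_def by (simp add: abs_le_iff less_imp_le order_trans[of "- 1" 0])
      then show "\<bar>N$i$j * c$j\<bar> \<le> \<bar>N$i$j\<bar>" by (simp add: abs_mult mult_left_le)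
    qed
    also have "\<dots> \<le> M - 1"
      unfolding M_def using member_le_sum[of i UNIV "\<lambda>i. \<Sum>j\<in>UNIV. \<bar>N$i$j\<bar>"] by (simp add: sum_nonneg)
    finally show ?thesis .
  qed
  define Z where "Z = {x::(real, 'n) vec. int_vec x \<and> (\<forall>i. \<bar>x$i\<bar> \<le> M)}"
  have finZ: "finite Z" unfolding Z_def by (rule finite_bounded_int_vec)
  have NS: "(*v) N ` ?S \<subseteq> Z"
  proof -
    have "\<bar>(N *v c)$i\<bar> \<le> M" if "c \<in> ?D" for c i using bd[OF that, of i] by linarith
    then show ?thesis by (auto simp: Z_def)
  qed
  have "inj ((*v) N)" by (metis NN'(2) injI)
  then have "inj_on ((*v) N) ?S" by (rule inj_on_subset) simp
  then show "finite ?S" by (rule finite_imageD[OF finite_subset[OF NS finZ]])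
  define E where "E = (*v) N ` ?D"
  have linN: "linear ((*v) N)" by simp
  have E: "E \<in> lmeasurable" "measure lebesgue E = \<bar>det N\<bar>"
    using measurable_linear_image[OF linN unit_cube_measure(1)]
      measure_linear_image[OF linN unit_cube_measure(1)]
    by (simp_all add: E_def unit_cube_measure(2))
  \<comment> \<open>\<open>P z\<close> below is the piece of \<open>E\<close> in the cube translated
    by \<open>z\<close>; \<open>T z\<close> is that piece moved back into the cube.\<close>
  define T where "T z = ?D \<inter> (\<lambda>x. x - z) ` E" for z
  define P where "P z = E \<inter> (\<lambda>x. x + z) ` ?D" for z
  have Tm: "T z \<in> lmeasurable" for z
    unfolding T_def using E(1) unit_cube_measure(1) measurable_translation_subtract
    by (intro fmeasurable.Int) auto
  have PT: "P z = (+) z ` T z" for z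
    unfolding P_def T_def by (auto simp: image_iff algebra_simps)
  have Pm: "P z \<in> lmeasurable" "measure lebesgue (P z) = measure lebesgue (T z)" for z
    unfolding PT using Tm by (auto simp: measure_translation intro: measurable_translation)
  have EP: "E = (\<Union>z\<in>Z. P z)"
  proof
    show "E \<subseteq> (\<Union>z\<in>Z. P z)"
    proof
      fix x assume x: "x \<in> E"
      then obtain c where c: "c \<in> ?D" "x = N *v c" by (auto simp: E_def)
      let ?z = "x - frac_vec x"
      have "\<bar>?z$i\<bar> \<le> M" for i
      proof -
        have "\<bar>x$i\<bar> \<le> M - 1" using bd c by simp
        moreover have "0 \<le> frac (x$i)" "frac (x$i) < 1" by (simp_all add: frac_lt_1)
        moreover have "?z$i = x$i - frac (x$i)" by (simp add: frac_vec_def)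
        ultimately show ?thesis by linarith
      qed
      then have "?z \<in> Z" by (simp add: Z_def int_vec_frac_vec)
      moreover have "x \<in> P ?z"
        using x frac_vec_in_cube[of x] by (auto simp: P_def image_iff intro!: bexI[of _ "frac_vec x"])
      ultimately show "x \<in> (\<Union>z\<in>Z. P z)" by blast
    qed
  qed (auto simp: P_def)
  have disj: "disjoint_family_on P Z"
    unfolding disjoint_family_on_def
  proof (intro ballI impI equals0I)
    fix z w x assume zw: "z \<in> Z" "w \<in> Z" "z \<noteq> w" "x \<in> P z \<inter> P w"
    then obtain a b where ab: "a \<in> ?D" "b \<in> ?D" "x = a + z" "x = b + w" by (auto simp: P_def)
    then have "a - b = w - z" by (metis add_diff_eq add.commute diff_add_eq diff_diff_eq2 eq_diff_eq)
    then have "int_vec (a - b)" using zw by (simp add: Z_def int_vec_diff)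
    then have "a = b" using ab unit_cube_unique by blast
    with ab zw show False by simp
  qed
  have count: "(\<Sum>z\<in>Z. indicat_real (T z) x) = real (card ?S) * indicat_real ?D x" for x
  proof (cases "x \<in> ?D")
    case False
    then show ?thesis by (simp add: T_def)
  next
    case True
    \<comment> \<open>Membership of \<open>x\<close> in \<open>T z\<close> means
      \<open>x + z = N c\<close> for some \<open>c\<close> in the cube. As \<open>z\<close> varies
      over these translates, \<open>N' z\<close> meets each class of \<open>N'\<close>-images of
      integer vectors modulo integer vectors once, and \<open>?S\<close> consists of the
      representatives in the cube.\<close>
    have "bij_betw (\<lambda>z. frac_vec (N' *v z)) {z\<in>Z. x \<in> T z} ?S"
    proof -
      \<comment> \<open>\<open>frac_vec (c + N' x)\<close> is the cube point whose image under
        \<open>N\<close> is \<open>x + z\<close>; subtracting \<open>x\<close> recovers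
        \<open>z\<close>.\<close>
      define g where "g c = N *v frac_vec (c + N' *v x) - x" for c
      show ?thesis
      proof (rule bij_betwI[where g = g])
        show "(\<lambda>z. frac_vec (N' *v z)) \<in> {z\<in>Z. x \<in> T z} \<rightarrow> ?S"
        proof
          fix z assume z: "z \<in> {z\<in>Z. x \<in> T z}"
          have "int_vec (N *v (N' *v z - frac_vec (N' *v z)))"
            by (intro int_vec_mult int int_vec_frac_vec)
          then have "int_vec (z - N *v frac_vec (N' *v z))"
            by (simp add: matrix_vector_mult_diff_distrib NN')
          moreover have "int_vec z" using z by (simp add: Z_def)
          ultimately have "int_vec (z - (z - N *v frac_vec (N' *v z)))" using int_vec_diff by blast
          then show "frac_vec (N' *v z) \<in> ?S" by (simp add: frac_vec_in_cube)
        qed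
        show "g \<in> ?S \<rightarrow> {z\<in>Z. x \<in> T z}"
        proof
          fix c assume c: "c \<in> ?S"
          have "int_vec (N *v (c + N' *v x - frac_vec (c + N' *v x)))"
            by (intro int_vec_mult int int_vec_frac_vec)
          then have "int_vec (N *v c + x - N *v frac_vec (c + N' *v x))"
            by (simp add: matrix_vector_mult_diff_distrib matrix_vector_right_distrib NN')
          moreover have "int_vec (N *v c)" using c by simp
          ultimately have "int_vec (N *v c - (N *v c + x - N *v frac_vec (c + N' *v x)))"
            using int_vec_diff by blast
          then have "int_vec (g c)" by (simp add: g_def algebra_simps)
          moreover have "\<bar>(g c)$i\<bar> \<le> M" for i
          proof -
            have "\<bar>(N *v frac_vec (c + N' *v x))$i\<bar> \<le> M - 1" by (rule bd[OF frac_vec_in_cube])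
            moreover have "0 \<le> x$i" "x$i < 1" using True by (auto simp: unit_cube_def)
            ultimately show ?thesis by (simp add: g_def)
          qed
          moreover have "x \<in> T (g c)"
            unfolding T_def E_def using True frac_vec_in_cube[of "c + N' *v x"]
            by (auto simp: g_def image_iff intro!: bexI[of _ "frac_vec (c + N' *v x)"])
          ultimately show "g c \<in> {z\<in>Z. x \<in> T z}" by (simp add: Z_def)
        qed
        have frac_eq: "frac_vec a = b" if "b \<in> ?D" "int_vec (b - a)" for a b :: "(real, 'n) vec"
        proof -
          have "int_vec (b - a + (a - frac_vec a))" using that int_vec_frac_vec by (intro int_vec_add)
          then show ?thesis using unit_cube_unique[OF that(1) frac_vec_in_cube[of a]] by simp
        qed
        show "g (frac_vec (N' *v z)) = z" if z: "z \<in> {z\<in>Z. x \<in> T z}" for z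
        proof -
          obtain c where c: "c \<in> ?D" "x = N *v c - z" using z by (auto simp: T_def E_def)
          have N'x: "N' *v x = c - N' *v z" by (simp add: c(2) matrix_vector_mult_diff_distrib NN')
          then have "frac_vec (frac_vec (N' *v z) + N' *v x) = c"
            using int_vec_frac_vec[of "N' *v z"] 
            by (intro frac_eq c(1)) (simp add: N'x)
          then show ?thesis by (simp add: g_def c(2))
        qed
        show "frac_vec (N' *v g c) = c" if c: "c \<in> ?S" for c
        proof (rule frac_eq)
          show "int_vec (c - N' *v g c)"
            using int_vec_frac_vec[of "c + N' *v x"]
            by (simp add: g_def matrix_vector_mult_diff_distrib NN' algebra_simps)
        qed (use c in simp)
      qed
    qed
    then have "card {z\<in>Z. x \<in> T z} = card ?S" by (rule bij_betw_same_card)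
    moreover have "(\<Sum>z\<in>Z. indicat_real (T z) x) = real (card {z\<in>Z. x \<in> T z})"
      unfolding indicator_def using finZ by (simp add: sum.If_cases Int_def)
    ultimately show ?thesis using True by simp
  qed
  have Ti: "integrable lebesgue (indicat_real (T z))" for z
    by (rule integrable_real_indicator[OF fmeasurableD[OF Tm]])
      (metis Tm fmeasurableD2 infinity_ennreal_def less_top)
  \<comment> \<open>The volume of \<open>E\<close> is summed over its pieces. Moved back into the
    cube, they have a counting function that is constant on a set of measure 1.\<close>
  have "\<bar>det N\<bar> = measure lebesgue (\<Union>z\<in>Z. P z)" using E EP by simp
  also have "\<dots> = (\<Sum>z\<in>Z. measure lebesgue (P z))"
    by (rule measure_finite_Union[OF finZ _ disj])
      (use fmeasurableD[OF Pm(1)] fmeasurableD2[OF Pm(1)] in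
        \<open>auto simp only: infinity_ennreal_def\<close>)
  also have "\<dots> = (\<Sum>z\<in>Z. integral\<^sup>L lebesgue (indicat_real (T z)))"
    by (simp add: Pm)
  also have "\<dots> = integral\<^sup>L lebesgue (\<lambda>x. \<Sum>z\<in>Z. indicat_real (T z) x)"
    by (rule Bochner_Integration.integral_sum [symmetric]) (rule Ti)
  also have "\<dots> = real (card ?S)"
    unfolding count by (simp add: unit_cube_measure)
  finally show "real (card ?S) = \<bar>det N\<bar>" ..
qed

section \<open>Lattices and period matrices\<close>

definition lin_comb :: "(4 \<Rightarrow> cspace) \<Rightarrow> real^4 \<Rightarrow> cspace" where
  "lin_comb b x = (\<Sum>i\<in>UNIV. x$i *\<^sub>R b i)"

lemma linear_lin_comb: "linear (lin_comb b)"
  by (rule linearI) (simp_all add: lin_comb_def scaleR_left_distrib sum.distrib scaleR_sum_right)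

lemma lin_comb_axis: "lin_comb b (axis i 1) = b i"
proof -
  have "lin_comb b (axis i 1) = (\<Sum>j\<in>UNIV. if j = i then b j else 0)"
    unfolding lin_comb_def by (rule sum.cong) (auto simp: axis_def)
  then show ?thesis by simp
qed

lemma linear_lin_comb_eq:
  fixes f :: "cspace \<Rightarrow> complex"
  assumes "linear f"
  shows "f (lin_comb b x) = (\<Sum>j\<in>UNIV. of_real (x$j) * f (b j))"
proof -
  have "f (lin_comb b x) = (\<Sum>j\<in>UNIV. f (x$j *\<^sub>R b j))"
    unfolding lin_comb_def by (rule linear_sum[OF assms])
  also have "\<dots> = (\<Sum>j\<in>UNIV. of_real (x$j) * f (b j))"
    unfolding linear_cmul[OF assms] by (simp only: scaleR_conv_of_real)
  finally show ?thesis .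
qed

text \<open>Independence gives injectivity; source and target both have real dimension 4.\<close>

lemma lattice_basis_bij:
  assumes "lattice_basis L b"
  shows "bij (lin_comb b)"
proof -
  have b: "inj b" "independent (range b)" using assms by (auto simp: lattice_basis_def)
  have "inj (lin_comb b)"
    unfolding linear_injective_0[OF linear_lin_comb]
  proof (intro allI impI)
    fix x assume "lin_comb b x = 0"
    then have "(\<Sum>y\<in>range b. x $ (the_inv b y) *\<^sub>R y) = 0"
      by (simp add: lin_comb_def sum.reindex[OF b(1)] the_inv_f_f[OF b(1)] o_def)
    then have "x $ (the_inv b (b i)) = 0" for i
      using b(2) independent_explicit[of "range b"] by (auto simp: dependent_finite)
    then show "x = 0" by (simp add: vec_eq_iff the_inv_f_f[OF b(1)])
  qed
  then have "dim (range (lin_comb b)) = DIM(cspace)"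
    using dim_image_eq[OF linear_lin_comb, of b UNIV] by (simp add: dim_UNIV)
  then have "span (range (lin_comb b)) = UNIV" by (simp only: dim_eq_full)
  moreover have "span (range (lin_comb b)) = range (lin_comb b)"
    using linear_subspace_image[OF linear_lin_comb subspace_UNIV] by (simp only: span_eq_iff)
  ultimately have "surj (lin_comb b)" by simp
  with \<open>inj (lin_comb b)\<close> show ?thesis by (rule bijI)
qed

lemma lattice_basis_lattice:
  assumes "lattice_basis L b"
  shows "L = lin_comb b ` {x. int_vec x}"
proof -
  have "L = {(\<Sum>i\<in>UNIV. of_int (n i) *\<^sub>R b i) | n :: 4 \<Rightarrow> int. True}"
    using assms by (simp add: lattice_basis_def)
  also have "\<dots> = lin_comb b ` {x. int_vec x}"
  proof safe
    fix n :: "4 \<Rightarrow> int"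
    show "(\<Sum>i\<in>UNIV. of_int (n i) *\<^sub>R b i) \<in> lin_comb b ` {x. int_vec x}"
      by (rule image_eqI[of _ _ "\<chi> i. of_int (n i)"]) (auto simp: lin_comb_def int_vec_def)
  next
    fix x :: "real^4" assume "int_vec x"
    then have "x$i = of_int \<lfloor>x$i\<rfloor>" for i by (simp add: int_vec_def)
    then show "\<exists>n :: 4 \<Rightarrow> int. lin_comb b x = (\<Sum>i\<in>UNIV. of_int (n i) *\<^sub>R b i) \<and> True"
      unfolding lin_comb_def by (intro exI[of _ "\<lambda>i. \<lfloor>x$i\<rfloor>"]) simp
  qed
  finally show ?thesis .
qed

lemma wedge22_eq_det:
  "wedge22 (wedge11 (\<phi> 1) (\<phi> 2)) (wedge11 (\<phi> 3) (\<phi> 4)) (b 1) (b 2) (b 3) (b 4)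
     = det (\<chi> (i::4) (j::4). \<phi> i (b j))"
  unfolding det_4 wedge22_def wedge11_def vec_lambda_beta by algebra

lemma det_of_real:
  "det (\<chi> i j. complex_of_real (A$i$j)) = of_real (det (A :: real^'n^'n))"
  by (simp add: det_def)

lemma det_of_rat:
  "det (\<chi> i j. (of_rat (A$i$j) :: 'a::field_char_0)) = of_rat (det (A :: rat^'n^'n))"
  by (simp add: det_def of_rat_sum of_rat_mult of_rat_prod)

lemma volume_form_swap: "volume_form q p r s = - volume_form p q r s"
  unfolding volume_form_def wedge22_def wedge11_def by algebra

text \<open>The value is the determinant of the real coordinates of the lattice basis, which is a
  real basis of the plane \<open>cspace\<close>.\<close>

lemma volume_form_nonzero:
  assumes "lattice_basis L b"
  shows "volume_form (b 1) (b 2) (b 3) (b 4) \<in> \<real> - {0}"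
proof -
  define Z :: "cspace \<Rightarrow> real^4" where
    "Z v = vector [Re (v$1), Im (v$1), Re (v$2), Im (v$2)]" for v
  define M :: "real^4^4" where "M = (\<chi> i j. Z (b j) $ i)"
  have "volume_form (b 1) (b 2) (b 3) (b 4) = det (\<chi> i j. complex_of_real (M$i$j))"
  proof -
    have "volume_form (b 1) (b 2) (b 3) (b 4) =
      wedge22 (wedge11 (\<lambda>v. complex_of_real (Z v $ 1)) (\<lambda>v. complex_of_real (Z v $ 2)))
        (wedge11 (\<lambda>v. complex_of_real (Z v $ 3)) (\<lambda>v. complex_of_real (Z v $ 4))) (b 1) (b 2) (b 3) (b 4)"
      by (simp only: volume_form_def Z_def vector_4)
    also have "\<dots> = det (\<chi> i j. complex_of_real (Z (b j) $ i))"
      by (rule wedge22_eq_det[of "\<lambda>i v. complex_of_real (Z v $ i)" b])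
    finally show ?thesis by (simp only: M_def vec_lambda_beta)
  qed
  then have vol: "volume_form (b 1) (b 2) (b 3) (b 4) = of_real (det M)"
    by (simp only: det_of_real)
  have "M *v x = Z (lin_comb b x)" for x
    unfolding vec_eq_iff forall_4
    by (simp add: M_def matrix_vector_mult_def Z_def lin_comb_def sum_4 mult.commute)
  moreover have "v = 0" if "Z v = 0" for v
    using that by (simp add: Z_def vec_eq_iff forall_4 forall_2 complex_eq_iff)
  moreover have "x = 0" if "lin_comb b x = 0" for x
    using lattice_basis_bij[OF assms] that linear_injective_0[OF linear_lin_comb]
    by (auto simp: bij_def)
  ultimately have "inj ((*v) M)"
    by (subst linear_injective_0) simp_all
  then have "invertible M" by (simp only: invertible_left_inverse matrix_left_invertible_injective)
  then have "det M \<noteq> 0" by (rule invertible_det_nz[THEN iffD1])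
  then show ?thesis unfolding vol by auto
qed

lemma lattice_basis_permute:
  assumes "lattice_basis L b" "bij \<sigma>"
  shows "lattice_basis L (b \<circ> \<sigma>)"
proof -
  have r: "range (b \<circ> \<sigma>) = range b" using bij_is_surj[OF assms(2)] by (metis image_comp)
  have "{(\<Sum>i\<in>UNIV. of_int (n i) *\<^sub>R (b \<circ> \<sigma>) i) | n :: 4 \<Rightarrow> int. True} =
    {(\<Sum>i\<in>UNIV. of_int (n i) *\<^sub>R b i) | n :: 4 \<Rightarrow> int. True}"
  proof safe
    fix n :: "4 \<Rightarrow> int"
    have "(\<Sum>i\<in>UNIV. of_int (n i) *\<^sub>R (b \<circ> \<sigma>) i) = (\<Sum>i\<in>UNIV. of_int (n (inv_into UNIV \<sigma> i)) *\<^sub>R b i)"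
      using sum.reindex_bij_betw[OF assms(2), of "\<lambda>i. of_int (n (inv_into UNIV \<sigma> i)) *\<^sub>R b i"]
        bij_is_inj[OF assms(2)] by simp
    then show "\<exists>m :: 4 \<Rightarrow> int. (\<Sum>i\<in>UNIV. of_int (n i) *\<^sub>R (b \<circ> \<sigma>) i) = (\<Sum>i\<in>UNIV. of_int (m i) *\<^sub>R b i) \<and> True"
      by (intro exI[of _ "\<lambda>i. n (inv_into UNIV \<sigma> i)"]) simp
    have "(\<Sum>i\<in>UNIV. of_int (n i) *\<^sub>R b i) = (\<Sum>i\<in>UNIV. of_int (n (\<sigma> i)) *\<^sub>R (b \<circ> \<sigma>) i)"
      using sum.reindex_bij_betw[OF assms(2), of "\<lambda>i. of_int (n i) *\<^sub>R b i"] by simp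
    then show "\<exists>m :: 4 \<Rightarrow> int. (\<Sum>i\<in>UNIV. of_int (n i) *\<^sub>R b i) = (\<Sum>i\<in>UNIV. of_int (m i) *\<^sub>R (b \<circ> \<sigma>) i) \<and> True"
      by (intro exI[of _ "\<lambda>i. n (\<sigma> i)"]) simp
  qed
  moreover have "inj (b \<circ> \<sigma>)" using assms by (simp add: lattice_basis_def bij_is_inj inj_compose)
  ultimately show ?thesis using assms(1) unfolding lattice_basis_def r by simp
qed

text \<open>Exchanging the first two basis vectors reverses the sign of the volume.\<close>

lemma oriented_lattice_basis_exists:
  assumes "is_lattice L"
  shows "\<exists>b. oriented_lattice_basis L b"
proof -
  obtain b where b: "lattice_basis L b" using assms by (auto simp: is_lattice_def)
  let ?vol = "volume_form (b 1) (b 2) (b 3) (b 4)"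
  have "Re ?vol \<noteq> 0"
    using volume_form_nonzero[OF b] by (auto simp: complex_is_Real_iff complex_eq_iff)
  then consider "0 < Re ?vol" | "Re ?vol < 0" by linarith
  then show ?thesis
  proof cases
    case 1
    with b show ?thesis by (auto simp: oriented_lattice_basis_def)
  next
    case 2
    let ?b = "b \<circ> Transposition.transpose 1 2"
    have "lattice_basis L ?b" by (rule lattice_basis_permute[OF b]) simp
    moreover have "volume_form (?b 1) (?b 2) (?b 3) (?b 4) = - ?vol"
      by (simp add: volume_form_swap[of "b 2" "b 1"])
    ultimately show ?thesis using 2 by (auto simp: oriented_lattice_basis_def)
  qed
qed

text \<open>Naming the choice made inside \<open>torus_trace\<close> allows the same basis to serve
  for traces and for lattice coordinates.\<close>

definition trace_basis :: "cspace set \<Rightarrow> 4 \<Rightarrow> cspace" where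
  "trace_basis L = (SOME b. oriented_lattice_basis L b)"

lemma lattice_trace_basis: "is_lattice L \<Longrightarrow> lattice_basis L (trace_basis L)"
  using someI_ex[OF oriented_lattice_basis_exists]
  by (auto simp: trace_basis_def oriented_lattice_basis_def)

lemma torus_trace_eq:
  "torus_trace L \<omega> = \<omega> (trace_basis L 1) (trace_basis L 2) (trace_basis L 3) (trace_basis L 4)"
  by (simp add: torus_trace_def trace_basis_def Let_def)

text \<open>Periods are rational because the basis vectors lie in the lattice, and the trace
  condition of an admissible basis is the determinant of the period matrix.\<close>

lemma admissible_period_matrix:
  assumes "is_lattice L" "admissible_basis L v"
  shows "\<exists>P :: rat^4^4. (\<forall>i j. v i (trace_basis L j) = of_rat (P$i$j)) \<and> det P = 1"
proof -
  have "trace_basis L j \<in> L" for j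
  proof -
    have "trace_basis L j \<in> lin_comb (trace_basis L) ` {x. int_vec x}"
      by (rule image_eqI[of _ _ "axis j 1"]) (simp add: lin_comb_axis, simp add: int_vec_def axis_def)
    then show ?thesis
      using lattice_basis_lattice[OF lattice_trace_basis[OF assms(1)]] by blast
  qed
  then have "v i (trace_basis L j) \<in> \<rat>" for i j
    using assms(2) by (auto simp: admissible_basis_def H1_basis_def H1_rat_def)
  then have "\<exists>q. v i (trace_basis L j) = of_rat q" for i j
    by (meson Rats_cases)
  then obtain p where p: "\<And>i j. v i (trace_basis L j) = of_rat (p i j)" by metis
  define P :: "rat^4^4" where "P = (\<chi> i j. p i j)"
  have P: "v i (trace_basis L j) = of_rat (P$i$j)" for i j by (simp add: P_def p)
  have "of_rat (det P) = det (\<chi> i j. v i (trace_basis L j))"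
    unfolding P by (rule det_of_rat [symmetric])
  also have "\<dots> = 1"
    using assms(2)
    unfolding admissible_basis_def torus_trace_eq wedge22_eq_det[of v "trace_basis L"] by (rule conjunct2)
  finally have "det P = 1" by simp
  with P show ?thesis by blast
qed

section \<open>Isogenies from integral matrices\<close>

lemma cspace_comm_group: "comm_group cspace_group"
proof (rule comm_groupI)
  fix x assume "x \<in> carrier cspace_group"
  show "\<exists>y\<in>carrier cspace_group. y \<otimes>\<^bsub>cspace_group\<^esub> x = \<one>\<^bsub>cspace_group\<^esub>"
    by (rule bexI[of _ "- x"]) (simp_all add: cspace_group_def)
qed (simp_all add: cspace_group_def algebra_simps)

lemma lattice_add_closed:
  assumes "lattice_basis L b"
  shows "0 \<in> L" and "x \<in> L \<Longrightarrow> y \<in> L \<Longrightarrow> x + y \<in> L" and "x \<in> L \<Longrightarrow> - x \<in> L"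
proof -
  have L: "z \<in> L \<longleftrightarrow> (\<exists>x. int_vec x \<and> z = lin_comb b x)" for z
    using lattice_basis_lattice[OF assms] by auto
  have lin: "lin_comb b 0 = 0" "lin_comb b p + lin_comb b q = lin_comb b (p + q)"
    "- lin_comb b p = lin_comb b (- p)" for p q
    using linear_lin_comb[of b] by (simp_all add: linear_0 linear_add linear_neg)
  show "0 \<in> L" unfolding L by (rule exI[of _ 0]) (simp add: lin int_vec_def)
  show "x + y \<in> L" if "x \<in> L" "y \<in> L"
  proof -
    from that obtain p q where "int_vec p" "x = lin_comb b p" "int_vec q" "y = lin_comb b q"
      unfolding L by blast
    then show ?thesis unfolding L using int_vec_add[of p q] by (auto simp: lin)
  qed
  show "- x \<in> L" if "x \<in> L"
  proof -
    from that obtain p where "int_vec p" "x = lin_comb b p" unfolding L by blast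
    then show ?thesis unfolding L by (intro exI[of _ "- p"]) (simp add: lin int_vec_def)
  qed
qed

lemma lattice_normal:
  assumes "lattice_basis L b"
  shows "L \<lhd> cspace_group"
proof -
  interpret comm_group cspace_group by (rule cspace_comm_group)
  have "inv\<^bsub>cspace_group\<^esub> x = - x" for x
    by (rule inv_equality) (simp_all add: cspace_group_def)
  then have "subgroup L cspace_group"
    using lattice_add_closed[OF assms] by unfold_locales (simp_all add: cspace_group_def)
  then show ?thesis by (rule subgroup_imp_normal)
qed

lemma mem_torus_proj: "x \<in> torus_proj L v \<longleftrightarrow> x - v \<in> L"
  by (auto simp: torus_proj_def r_coset_def cspace_group_def algebra_simps
      intro!: bexI[of _ "x - v"])

lemma torus_proj_eq_iff:
  assumes "lattice_basis L b"
  shows "torus_proj L u = torus_proj L v \<longleftrightarrow> u - v \<in> L"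
proof
  assume "torus_proj L u = torus_proj L v"
  moreover have "u \<in> torus_proj L u" by (simp add: mem_torus_proj lattice_add_closed(1)[OF assms])
  ultimately show "u - v \<in> L" by (simp add: mem_torus_proj)
next
  assume uv: "u - v \<in> L"
  have "x - u \<in> L \<longleftrightarrow> x - v \<in> L" for x
  proof
    assume "x - u \<in> L"
    from lattice_add_closed(2)[OF assms this uv] show "x - v \<in> L" by simp
  next
    assume "x - v \<in> L"
    from lattice_add_closed(2)[OF assms this lattice_add_closed(3)[OF assms uv]] show "x - u \<in> L"
      by (simp add: algebra_simps)
  qed
  then show "torus_proj L u = torus_proj L v" by (auto simp: mem_torus_proj)
qed

lemma carrier_torus: "carrier (torus L) = range (torus_proj L)"
  by (auto simp: torus_def FactGroup_def RCOSETS_def torus_proj_def cspace_group_def)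

lemma torus_mult:
  assumes "lattice_basis L b"
  shows "torus_proj L u \<otimes>\<^bsub>torus L\<^esub> torus_proj L v = torus_proj L (u + v)"
  using normal.rcos_sum[OF lattice_normal[OF assms], of u v]
  by (simp add: torus_def torus_proj_def FactGroup_def) (simp add: cspace_group_def)

lemma torus_one:
  assumes "lattice_basis L b"
  shows "\<one>\<^bsub>torus L\<^esub> = torus_proj L 0"
  using mem_torus_proj[of _ L 0] by (auto simp: torus_def FactGroup_def)

section \<open>Maps of tori induced by linear maps\<close>

definition torus_map :: "cspace set \<Rightarrow> cspace set \<Rightarrow> (cspace \<Rightarrow> cspace) \<Rightarrow> cspace set \<Rightarrow> cspace set" where
  "torus_map L M F C = torus_proj M (F (SOME u. C = torus_proj L u))"

lemma torus_map_proj: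
  assumes "lattice_basis L b" "lattice_basis M a" "linear F" "F ` L \<subseteq> M"
  shows "torus_map L M F (torus_proj L u) = torus_proj M (F u)"
proof -
  define w where "w = (SOME w. torus_proj L u = torus_proj L w)"
  have "torus_proj L u = torus_proj L w" unfolding w_def by (rule someI[of _ u]) simp
  then have "w - u \<in> L" using torus_proj_eq_iff[OF assms(1)] by metis
  then have "F w - F u \<in> M" using assms(3,4) by (auto simp: linear_diff [symmetric])
  then have "torus_proj M (F w) = torus_proj M (F u)" by (simp only: torus_proj_eq_iff[OF assms(2)])
  then show ?thesis by (simp only: torus_map_def w_def)
qed

text \<open>Two linear lifts differ by a vector of the discrete group \<open>M\<close> at every
  point. Applied to all real multiples of \<open>v\<close>, this makes every real multiple of each
  coordinate of the difference an integer, so the difference vanishes.\<close>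

lemma analytic_rep_torus_map:
  assumes b: "lattice_basis L b" and a: "lattice_basis M a" and F: "clinear_map F" "F ` L \<subseteq> M"
  shows "analytic_rep L M (torus_map L M F) = F"
  unfolding analytic_rep_def
proof (rule the_equality)
  have linF: "linear F" using F(1) by (simp add: clinear_map_def)
  note proj = torus_map_proj[OF b a linF F(2)]
  show "clinear_map F \<and> (\<forall>v. torus_map L M F (torus_proj L v) = torus_proj M (F v))"
    using F(1) proj by simp
  fix F' assume F': "clinear_map F' \<and> (\<forall>v. torus_map L M F (torus_proj L v) = torus_proj M (F' v))"
  then have linF': "linear F'" by (simp add: clinear_map_def)
  have mem: "F' v - F v \<in> M" for v
    using F' proj torus_proj_eq_iff[OF a] by metis
  show "F' = F"
  proof
    fix v
    obtain x where x: "F' v - F v = lin_comb a x"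
      using lattice_basis_bij[OF a] by (metis bij_pointE)
    have int: "t * x$i \<in> \<int>" for t i
    proof -
      have "F' (t *\<^sub>R v) - F (t *\<^sub>R v) = lin_comb a (t *\<^sub>R x)"
        by (simp add: linear_cmul linF linF' linear_lin_comb x [symmetric] scaleR_diff_right)
      with mem[of "t *\<^sub>R v"] obtain y where "int_vec y" "lin_comb a (t *\<^sub>R x) = lin_comb a y"
        using lattice_basis_lattice[OF a] by auto
      then have "int_vec (t *\<^sub>R x)"
        using lattice_basis_bij[OF a] by (metis bij_def injD)
      then show ?thesis by (simp add: int_vec_def)
    qed
    have "x$i = 0" for i
    proof (rule ccontr)
      assume "x$i \<noteq> 0"
      \<comment> \<open>This multiple would turn the nonzero coordinate into 1/2.\<close>
      with int[of "1 / (2 * x$i)" i] have "(1/2 :: real) \<in> \<int>" by simp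
      then obtain k :: int where "(1/2 :: real) = of_int k" by (auto elim: Ints_cases)
      then have "real_of_int (2 * k) = real_of_int 1" by simp
      then have "2 * k = 1" by (simp only: of_int_eq_iff)
      then show False by presburger
    qed
    then have "x = 0" by (simp add: vec_eq_iff)
    with x show "F' v = F v" by (simp add: linear_0[OF linear_lin_comb])
  qed
qed

text \<open>In lattice coordinates a kernel element has exactly one representative \<open>c\<close>
  in the unit cube, with \<open>N c\<close> integral; the count of lattice points then gives the
  degree. Surjectivity comes from the real inverse of \<open>N\<close>.\<close>

lemma isogeny_torus_map:
  fixes N :: "real^4^4"
  assumes b: "lattice_basis L b" and a: "lattice_basis M a" and F: "clinear_map F"
    and N: "\<And>x. F (lin_comb b x) = lin_comb a (N *v x)" "\<And>i j. N$i$j \<in> \<int>" "det N \<noteq> 0"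
  shows "isogeny L M (torus_map L M F)"
    and "real (isogeny_degree L M (torus_map L M F)) = \<bar>det N\<bar>"
    and "F ` L \<subseteq> M"
proof -
  have linF: "linear F" using F by (simp add: clinear_map_def)
  let ?f = "torus_map L M F"
  have memL: "lin_comb b x \<in> L \<longleftrightarrow> int_vec x" for x
    using lattice_basis_lattice[OF b] lattice_basis_bij[OF b] by (auto simp: bij_def inj_image_mem_iff)
  have memM: "lin_comb a x \<in> M \<longleftrightarrow> int_vec x" for x
    using lattice_basis_lattice[OF a] lattice_basis_bij[OF a] by (auto simp: bij_def inj_image_mem_iff)
  have bsurj: "\<exists>x. u = lin_comb b x" for u
    using lattice_basis_bij[OF b] by (metis bij_pointE)
  show FL: "F ` L \<subseteq> M"
  proof
    fix u assume "u \<in> F ` L"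
    then obtain x where "u = F (lin_comb b x)" "int_vec x" using bsurj memL by (metis imageE)
    then show "u \<in> M" using int_vec_mult[OF N(2)] by (simp add: N(1) memM)
  qed
  note proj = torus_map_proj[OF b a linF FL]
  have "invertible N" using N(3) by (simp add: invertible_det_nz)
  then obtain N' where N': "N ** N' = mat 1" by (auto simp: invertible_def)
  have surjF: "\<exists>u. F u = w" for w
  proof -
    obtain y where "w = lin_comb a y" using lattice_basis_bij[OF a] by (metis bij_pointE)
    then have "F (lin_comb b (N' *v y)) = w" by (simp add: N(1) matrix_vector_mul_assoc N')
    then show ?thesis by blast
  qed
  let ?S = "{c \<in> unit_cube. int_vec (N *v c)}"
  have ker: "kernel (torus L) (torus M) ?f = (\<lambda>c. torus_proj L (lin_comb b c)) ` ?S"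
  proof (intro equalityI subsetI)
    fix C assume "C \<in> kernel (torus L) (torus M) ?f"
    then obtain u where u: "C = torus_proj L u" "torus_proj M (F u) = torus_proj M 0"
      by (auto simp: kernel_def carrier_torus proj torus_one[OF a])
    obtain x where x: "u = lin_comb b x" using bsurj by blast
    have "int_vec (N *v x)"
      using u(2) by (simp add: torus_proj_eq_iff[OF a] x N(1) memM)
    moreover have "int_vec (N *v (x - frac_vec x))" by (intro int_vec_mult N int_vec_frac_vec)
    ultimately have "int_vec (N *v x - N *v (x - frac_vec x))" by (rule int_vec_diff)
    then have "frac_vec x \<in> ?S" by (simp add: matrix_vector_mult_diff_distrib frac_vec_in_cube)
    moreover have "C = torus_proj L (lin_comb b (frac_vec x))"
      unfolding u(1) torus_proj_eq_iff[OF b] x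
      by (simp add: linear_diff[OF linear_lin_comb, symmetric] memL int_vec_frac_vec)
    ultimately show "C \<in> (\<lambda>c. torus_proj L (lin_comb b c)) ` ?S" by blast
  next
    fix C assume "C \<in> (\<lambda>c. torus_proj L (lin_comb b c)) ` ?S"
    then obtain c where c: "int_vec (N *v c)" "C = torus_proj L (lin_comb b c)" by blast
    have "torus_proj M (F (lin_comb b c)) = torus_proj M 0"
      using c(1) by (simp add: torus_proj_eq_iff[OF a] N(1) memM)
    then show "C \<in> kernel (torus L) (torus M) ?f"
      by (simp add: kernel_def carrier_torus proj torus_one[OF a] c(2))
  qed
  have inj: "inj_on (\<lambda>c. torus_proj L (lin_comb b c)) ?S"
  proof (rule inj_onI)
    fix c c' assume c: "c \<in> ?S" "c' \<in> ?S" "torus_proj L (lin_comb b c) = torus_proj L (lin_comb b c')"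
    then have "int_vec (c - c')"
      by (simp add: torus_proj_eq_iff[OF b] linear_diff[OF linear_lin_comb, symmetric] memL)
    then show "c = c'" using c unit_cube_unique by blast
  qed
  show "real (isogeny_degree L M ?f) = \<bar>det N\<bar>"
    unfolding isogeny_degree_def ker card_image[OF inj]
    by (rule card_cube_lattice_points(2)[OF N(2,3)])
  have "?f \<in> hom (torus L) (torus M)"
  proof (rule homI)
    show "?f C \<in> carrier (torus M)" if "C \<in> carrier (torus L)" for C
      using that by (auto simp: carrier_torus proj)
    show "?f (C \<otimes>\<^bsub>torus L\<^esub> D) = ?f C \<otimes>\<^bsub>torus M\<^esub> ?f D"
      if "C \<in> carrier (torus L)" "D \<in> carrier (torus L)" for C D
      using that by (auto simp: carrier_torus proj torus_mult[OF a] torus_mult[OF b] linear_add[OF linF])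
  qed
  moreover have "torus_holomorphic L M ?f"
    unfolding torus_holomorphic_def
  proof (intro allI exI conjI ballI)
    show "open (UNIV :: cspace set)" by simp
    show "?f (torus_proj L u) = torus_proj M (F u)" for u by (rule proj)
    show "clinear_map F" by (rule F)
    show "(F has_derivative F) (at u)" for u
      using linF by (intro bounded_linear_imp_has_derivative) (simp add: linear_linear)
  qed simp
  moreover have "?f ` carrier (torus L) = carrier (torus M)"
  proof -
    have "torus_proj M w \<in> ?f ` range (torus_proj L)" for w
      using surjF[of w] proj by (metis rangeI image_eqI)
    then show ?thesis by (auto simp: carrier_torus proj)
  qed
  moreover have "finite (kernel (torus L) (torus M) ?f)"
    unfolding ker by (intro finite_imageI card_cube_lattice_points(1)[OF N(2,3)])
  ultimately show "isogeny L M ?f" by (simp add: isogeny_def)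
qed

section \<open>Two-forms in coordinates\<close>

definition wedge_form :: "(4 \<Rightarrow> form1) \<Rightarrow> complex^6 \<Rightarrow> form2" where
  "wedge_form v z = (\<lambda>u u'. \<Sum>k\<in>UNIV. z$k * associated_basis v k u u')"

text \<open>The Plucker coordinates of \<open>f ^ g\<close>, that is, the two by two minors in the
  order of \<open>associated_basis\<close>.\<close>

definition wedge_coords :: "'a::comm_ring_1^4 \<Rightarrow> 'a^4 \<Rightarrow> 'a^6" where
  "wedge_coords f g = vector [f$1 * g$2 - f$2 * g$1, f$1 * g$3 - f$3 * g$1, f$1 * g$4 - f$4 * g$1,
     f$2 * g$3 - f$3 * g$2, f$2 * g$4 - f$4 * g$2, f$3 * g$4 - f$4 * g$3]"

text \<open>With \<open>snd_index\<close> this lists the pairs \<open>i < j\<close>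
  lexicographically, replacing case distinctions by indices.\<close>

definition fst_index :: "6 \<Rightarrow> 4" where
  "fst_index k = (if k = 1 \<or> k = 2 \<or> k = 3 then 1 else if k = 4 \<or> k = 5 then 2 else 3)"

definition snd_index :: "6 \<Rightarrow> 4" where
  "snd_index k = (if k = 1 then 2 else if k = 2 \<or> k = 4 then 3 else 4)"

lemma associated_basis_index: "associated_basis v k = wedge11 (v (fst_index k)) (v (snd_index k))"
  using exhaust_6[of k] by (auto simp: associated_basis_def fst_index_def snd_index_def)

lemma wedge_form_axis: "wedge_form v (axis k 1) = associated_basis v k"
proof -
  have "wedge_form v (axis k 1) u u' = (\<Sum>j\<in>UNIV. if j = k then associated_basis v j u u' else 0)" for u u'
    unfolding wedge_form_def by (rule sum.cong) (auto simp: axis_def)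
  then show ?thesis by (simp add: fun_eq_iff)
qed

lemma wedge_form_add: "wedge_form v (x + y) = (\<lambda>u u'. wedge_form v x u u' + wedge_form v y u u')"
  by (simp add: wedge_form_def distrib_right sum.distrib)

lemma wedge_form_scale: "wedge_form v (c *s x) = (\<lambda>u u'. c * wedge_form v x u u')"
  by (simp add: wedge_form_def sum_distrib_left mult.assoc)

lemma wedge11_wedge_form:
  "wedge11 (\<lambda>u. \<Sum>i\<in>UNIV. f$i * v i u) (\<lambda>u. \<Sum>i\<in>UNIV. g$i * v i u) = wedge_form v (wedge_coords f g)"
proof (intro ext)
  fix u u'
  show "wedge11 (\<lambda>u. \<Sum>i\<in>UNIV. f$i * v i u) (\<lambda>u. \<Sum>i\<in>UNIV. g$i * v i u) u u' = wedge_form v (wedge_coords f g) u u'"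
    unfolding wedge_form_def sum_6 sum_4 wedge_coords_def vector_6 associated_basis_index wedge11_def
    by (simp add: fst_index_def snd_index_def, algebra)
qed

lemma wedge_form_in_wedge_span:
  assumes "\<And>k i. (\<lambda>u. z$k * v i u) \<in> A" "\<And>i. v i \<in> B"
  shows "wedge_form v z \<in> wedge_span A B"
proof -
  \<comment> \<open>\<open>wedge_span\<close> sums over an initial segment of the naturals, so the
    six indices are enumerated from 0. Each coefficient is absorbed into the first factor.\<close>
  define \<kappa> :: "nat \<Rightarrow> 6" where "\<kappa> = (!) [1, 2, 3, 4, 5, 6]"
  define \<phi> where "\<phi> = (\<lambda>n. (\<lambda>u. z$\<kappa> n * v (fst_index (\<kappa> n)) u))"
  define \<eta> where "\<eta> = (\<lambda>n. v (snd_index (\<kappa> n)))"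
  have "wedge_form v z = (\<lambda>u u'. \<Sum>i<6. wedge11 (\<phi> i) (\<eta> i) u u')"
    unfolding wedge_form_def sum_6
    by (simp add: fun_eq_iff eval_nat_numeral \<kappa>_def \<phi>_def \<eta>_def associated_basis_index wedge11_def algebra_simps)
  moreover have "\<forall>i<6. \<phi> i \<in> A \<and> \<eta> i \<in> B" using assms by (simp add: \<phi>_def \<eta>_def)
  ultimately show ?thesis unfolding wedge_span_def by blast
qed

lemma linear_mult_form: "linear (\<phi> :: form1) \<Longrightarrow> linear (\<lambda>u. c * \<phi> u)"
  by (rule linearI) (simp_all add: linear_add linear_cmul distrib_left)

lemma wedge_form_in_H2_complex: "(\<And>i. linear (v i)) \<Longrightarrow> wedge_form v z \<in> H2_complex"
  unfolding H2_complex_def by (rule wedge_form_in_wedge_span) (simp_all add: H1_complex_def linear_mult_form)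

section \<open>Rational coordinates and complex coefficients\<close>

definition of_rat_vec :: "rat^'n \<Rightarrow> 'a::field_char_0^'n" where
  "of_rat_vec x = (\<chi> i. of_rat (x$i))"

definition of_rat_mat :: "rat^'n^'m \<Rightarrow> 'a::field_char_0^'n^'m" where
  "of_rat_mat M = (\<chi> i j. of_rat (M$i$j))"

lemma of_rat_mat_mult: "of_rat_mat (M ** N) = of_rat_mat M ** of_rat_mat N"
  by (simp add: of_rat_mat_def matrix_matrix_mult_def vec_eq_iff of_rat_sum of_rat_mult)

lemma of_rat_mat_vec: "of_rat_vec (M *v x) = of_rat_mat M *v of_rat_vec x"
  by (simp add: of_rat_mat_def of_rat_vec_def matrix_vector_mult_def vec_eq_iff of_rat_sum of_rat_mult)

lemma det_of_rat_mat: "det (of_rat_mat M) = of_rat (det M)"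
  unfolding of_rat_mat_def by (rule det_of_rat)

lemma wedge_form_in_H2_rat:
  assumes "\<And>i. v i \<in> H1_rat L"
  shows "wedge_form v (of_rat_vec x) \<in> H2_rat L"
  unfolding H2_rat_def
  by (rule wedge_form_in_wedge_span) (use assms in \<open>auto simp: H1_rat_def of_rat_vec_def linear_mult_form\<close>)

text \<open>The coefficients come from inverting the period matrix over the complex numbers; linear
  forms that agree on a lattice basis agree everywhere.\<close>

lemma form1_expansion:
  fixes v :: "4 \<Rightarrow> form1" and \<phi> :: form1
  assumes b: "lattice_basis L b" and v: "\<And>i. linear (v i)" and P: "\<And>i j. v i (b j) = of_rat (P$i$j)"
    and det: "det P = 1" and \<phi>: "linear \<phi>"
  obtains f where "\<phi> = (\<lambda>u. \<Sum>i\<in>UNIV. f$i * v i u)"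
proof -
  let ?P = "of_rat_mat P :: complex^4^4"
  have "invertible ?P" by (simp add: invertible_det_nz det_of_rat_mat det)
  then obtain P' where P': "P' ** ?P = mat 1" by (auto simp: invertible_def)
  define p where "p = (\<chi> j. \<phi> (b j))"
  define f where "f = p v* P'"
  have "f v* ?P = p" by (simp add: f_def vector_matrix_mul_assoc P')
  then have fP: "(\<Sum>i\<in>UNIV. f$i * of_rat (P$i$j)) = \<phi> (b j)" for j
    by (simp add: vec_eq_iff p_def vector_matrix_mult_def of_rat_mat_def mult.commute)
  have lin: "linear (\<lambda>u. \<Sum>i\<in>UNIV. f$i * v i u)"
    by (intro linear_compose_sum ballI linear_mult_form v)
  have "\<phi> u = (\<Sum>i\<in>UNIV. f$i * v i u)" for u
  proof -
    obtain x where x: "u = lin_comb b x" using lattice_basis_bij[OF b] by (metis bij_pointE)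
    show ?thesis unfolding x linear_lin_comb_eq[OF \<phi>] linear_lin_comb_eq[OF lin] by (simp add: P fP)
  qed
  then show thesis by (intro that[of f]) (simp add: fun_eq_iff)
qed

lemma H2_complex_wedge_form:
  fixes v :: "4 \<Rightarrow> form1"
  assumes b: "lattice_basis L b" and v: "\<And>i. linear (v i)" and P: "\<And>i j. v i (b j) = of_rat (P$i$j)"
    and det: "det P = 1" and "\<alpha> \<in> H2_complex"
  obtains z where "\<alpha> = wedge_form v z"
proof -
  obtain n :: nat and \<phi> \<eta> where \<alpha>: "\<alpha> = (\<lambda>u u'. \<Sum>i<n. wedge11 (\<phi> i) (\<eta> i) u u')"
    and lin: "\<And>i. i < n \<Longrightarrow> linear (\<phi> i) \<and> linear (\<eta> i)"
    using assms(5) by (auto simp: H2_complex_def wedge_span_def H1_complex_def)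
  have "\<exists>z. wedge11 (\<phi> i) (\<eta> i) = wedge_form v z" if i: "i < n" for i
  proof -
    obtain f where f: "\<phi> i = (\<lambda>u. \<Sum>i\<in>UNIV. f$i * v i u)"
      using form1_expansion[OF b v P det] lin[OF i] by blast
    obtain g where g: "\<eta> i = (\<lambda>u. \<Sum>i\<in>UNIV. g$i * v i u)"
      using form1_expansion[OF b v P det] lin[OF i] by blast
    show ?thesis unfolding f g wedge11_wedge_form by blast
  qed
  then obtain z where z: "\<And>i. i < n \<Longrightarrow> wedge11 (\<phi> i) (\<eta> i) = wedge_form v (z i)" by metis
  have "wedge_form v (\<Sum>i<m. z i) = (\<lambda>u u'. \<Sum>i<m. wedge_form v (z i) u u')" for m
    by (induction m) (simp_all add: wedge_form_add, simp add: wedge_form_def)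
  with z have "\<alpha> = wedge_form v (\<Sum>i<n. z i)" unfolding \<alpha> by simp
  then show thesis by (rule that)
qed

section \<open>The intersection pairing in coordinates\<close>

lemma wedge22_sum_left:
  "wedge22 (\<lambda>u u'. \<Sum>k\<in>S. x k * \<alpha> k u u') \<beta> p q r s = (\<Sum>k\<in>S. x k * wedge22 (\<alpha> k) \<beta> p q r s)"
  unfolding wedge22_def
  by (simp add: sum_distrib_right sum_subtractf sum.distrib distrib_left right_diff_distrib mult.assoc)

lemma wedge22_commute: "wedge22 \<alpha> \<beta> p q r s = wedge22 \<beta> \<alpha> p q r s"
  by (simp add: wedge22_def)

lemma wedge22_repeated:
  "wedge22 (wedge11 f g) (wedge11 f h) p q r s = 0"
  "wedge22 (wedge11 f g) (wedge11 h f) p q r s = 0"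
  "wedge22 (wedge11 f g) (wedge11 g h) p q r s = 0"
  "wedge22 (wedge11 f g) (wedge11 h g) p q r s = 0"
  by (simp_all add: wedge22_def wedge11_def algebra_simps)

lemma wedge22_permuted:
  "wedge22 (wedge11 f h) (wedge11 g k) p q r s = - wedge22 (wedge11 f g) (wedge11 h k) p q r s"
  "wedge22 (wedge11 f k) (wedge11 g h) p q r s = wedge22 (wedge11 f g) (wedge11 h k) p q r s"
  unfolding wedge22_def wedge11_def by algebra+

text \<open>A repeated one-form kills the product, so only complementary index pairs survive, with
  the sign of the shuffle; these are the coefficients of \<open>plucker\<close>.\<close>

lemma wedge22_associated_basis:
  "wedge22 (associated_basis v k) (associated_basis v l) p q r s =
     plucker (axis k 1) (axis l 1) * wedge22 (wedge11 (v 1) (v 2)) (wedge11 (v 3) (v 4)) p q r s"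
  using exhaust_6[of k] exhaust_6[of l]
  by (elim disjE) (simp_all add: plucker_def axis_def associated_basis_def wedge22_repeated
      wedge22_permuted(1)[of "v 1" "v 3" "v 2"] wedge22_permuted(2)[of "v 1" "v 4" "v 2"]
      wedge22_commute[of "wedge11 (v 2) _" "wedge11 (v 1) _"]
      wedge22_commute[of "wedge11 (v 3) (v 4)" "wedge11 (v 1) (v 2)"])

lemma wedge22_wedge_form:
  "wedge22 (wedge_form v x) (wedge_form v y) p q r s =
     plucker x y * wedge22 (wedge11 (v 1) (v 2)) (wedge11 (v 3) (v 4)) p q r s"
proof -
  have "wedge22 (wedge_form v x) (wedge_form v y) p q r s =
    (\<Sum>k\<in>UNIV. x$k * (\<Sum>l\<in>UNIV. y$l * wedge22 (associated_basis v l) (associated_basis v k) p q r s))"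
    unfolding wedge_form_def wedge22_sum_left
    by (subst wedge22_commute) (simp only: wedge22_sum_left)
  also have "\<dots> = (\<Sum>k\<in>UNIV. x$k * (\<Sum>l\<in>UNIV. y$l * plucker (axis l 1) (axis k 1)))
      * wedge22 (wedge11 (v 1) (v 2)) (wedge11 (v 3) (v 4)) p q r s"
    unfolding wedge22_associated_basis by (simp add: sum_distrib_right sum_distrib_left mult.assoc)
  also have "(\<Sum>k\<in>UNIV. x$k * (\<Sum>l\<in>UNIV. y$l * plucker (axis l 1) (axis k 1))) = plucker x y"
    unfolding sum_6 by (simp add: plucker_def axis_def)
  finally show ?thesis .
qed

lemma plucker_of_rat_vec: "plucker (of_rat_vec x) (of_rat_vec y) = of_rat (plucker x y)"
  by (simp add: plucker_def of_rat_vec_def of_rat_add of_rat_diff of_rat_mult)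

lemma H2_pairing_wedge_form:
  assumes "admissible_basis L v"
  shows "H2_pairing L (wedge_form v (of_rat_vec x)) (wedge_form v (of_rat_vec y)) = of_rat (plucker x y)"
  using assms
  by (simp add: H2_pairing_def torus_trace_eq wedge22_wedge_form plucker_of_rat_vec admissible_basis_def)

section \<open>Second exterior powers, pullback and complexification\<close>

lemma skew_inj: "skew x = skew y \<Longrightarrow> x = y"
  by (simp add: skew_def vec_eq_iff forall_4 forall_6)

text \<open>Congruence of skew matrices by \<open>G\<close> is the second exterior power of
  \<open>G\<close>: it sends \<open>e_i ^ e_j\<close> to \<open>G e_i ^ G e_j\<close>.\<close>

lemma conj_skew_axis:
  "G ** skew (axis k 1) ** transpose G
     = skew (wedge_coords (column (fst_index k) G) (column (snd_index k) G))"
  using exhaust_6[of k]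
  by (elim disjE) (simp_all add: fst_index_def snd_index_def wedge_coords_def skew_def axis_def
      matrix_matrix_mult_def transpose_def column_def vec_eq_iff forall_4 sum_4 algebra_simps)

lemma of_rat_vec_wedge: "of_rat_vec (wedge_coords f g) = wedge_coords (of_rat_vec f) (of_rat_vec g)"
  by (simp add: wedge_coords_def of_rat_vec_def vec_eq_iff forall_6 of_rat_diff of_rat_mult)

lemma matrix_vector_mult_axis: "(A :: 'a::comm_ring_1^'n^'m) *v axis k 1 = column k A"
  by (simp add: matrix_vector_mult_def column_def axis_def vec_eq_iff mult_delta_right)

text \<open>Column \<open>i\<close> of \<open>G\<close> holds the coefficients of the pullback of
  \<open>v i\<close>. The pullback of a product of two basis forms has the minors of two columns as
  coordinates, and the hypothesis on \<open>G\<close> identifies these with \<open>d\<close> times a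
  column of \<open>A\<close>.\<close>

lemma associated_basis_pullback:
  assumes F: "\<And>i u. v i (F u) = (\<Sum>j\<in>UNIV. of_rat (G$j$i) * w j u)"
    and G: "\<And>x. G ** skew x ** transpose G = skew (d *s (A *v x))"
  shows "associated_basis v k (F u) (F u') = of_rat d * wedge_form w (of_rat_vec (column k A)) u u'"
proof -
  let ?i = "fst_index k" and ?j = "snd_index k"
  have "skew (wedge_coords (column ?i G) (column ?j G)) = skew (d *s column k A)"
    using G[of "axis k 1"] unfolding conj_skew_axis matrix_vector_mult_axis .
  then have "wedge_coords (column ?i G) (column ?j G) = d *s column k A" by (rule skew_inj)
  then have coords: "wedge_coords (of_rat_vec (column ?i G)) (of_rat_vec (column ?j G))
      = of_rat d *s (of_rat_vec (column k A) :: complex^6)"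
    by (simp add: of_rat_vec_wedge [symmetric]) (simp add: of_rat_vec_def vec_eq_iff of_rat_mult)
  have "associated_basis v k (F u) (F u') =
    wedge11 (\<lambda>u. \<Sum>j\<in>UNIV. of_rat_vec (column ?i G) $ j * w j u)
      (\<lambda>u. \<Sum>j\<in>UNIV. of_rat_vec (column ?j G) $ j * w j u) u u'"
    unfolding associated_basis_index wedge11_def F by (simp add: of_rat_vec_def column_def)
  also have "\<dots> = of_rat d * wedge_form w (of_rat_vec (column k A)) u u'"
    unfolding wedge11_wedge_form coords wedge_form_scale ..
  finally show ?thesis .
qed

lemma of_real_of_rat: "of_real (of_rat q) = (of_rat q :: complex)"
proof (cases q)
  case (Fract a b)
  then show ?thesis by (simp add: of_rat_rat)
qed

lemma common_denominator:
  assumes "finite (S :: rat set)"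
  obtains n :: int where "n > 0" "\<And>q. q \<in> S \<Longrightarrow> of_int n * q \<in> \<int>"
proof -
  have "\<exists>n>0. \<forall>q\<in>S. (of_int n * q :: rat) \<in> \<int>"
    using assms
  proof (induction rule: finite_induct)
    case empty
    then show ?case by (intro exI[of _ 1]) simp
  next
    case (insert x S)
    then obtain n where n: "n > 0" "\<forall>q\<in>S. (of_int n * q :: rat) \<in> \<int>" by blast
    obtain a b where x: "x = Fract a b" "b > 0" by (cases x) auto
    have bx: "of_int b * x = of_int a" using x by (simp add: Fract_of_int_quotient)
    show ?case
    proof (intro exI conjI ballI)
      show "n * b > 0" using n x by simp
      fix q assume q: "q \<in> insert x S"
      show "of_int (n * b) * q \<in> \<int>"
      proof (cases "q = x")
        case True
        then have "of_int (n * b) * q = of_int (n * a)" by (simp add: bx mult.assoc)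
        then show ?thesis by (simp only: Ints_of_int)
      next
        case False
        then have "of_int n * q \<in> \<int>" using n q by blast
        then have "of_int b * (of_int n * q) \<in> \<int>" by (rule Ints_mult[OF Ints_of_int])
        moreover have "of_int (n * b) * q = of_int b * (of_int n * q)" by (simp add: mult_ac)
        ultimately show ?thesis by (simp only:)
      qed
    qed
  qed
  then show thesis using that by blast
qed

lemma det_scale: "det (\<chi> i j. c * M$i$j) = c ^ CARD('n) * det (M :: 'a::comm_ring_1^'n^'n)"
  by (simp add: det_def prod.distrib sum_distrib_left mult_ac)

text \<open>The associated basis consists of rational forms, where \<open>\<Psi>\<close> agrees with
  \<open>\<psi>\<close>; complex linearity determines the remaining values.\<close>

lemma complexification_wedge_form:
  assumes L: "\<And>i. v i \<in> H1_rat L"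
    and \<Psi>: "complexification L \<psi> \<Psi>"
    and A: "matrix_wrt (associated_basis v) (associated_basis w) \<psi> A"
  shows "\<Psi> (wedge_form v z) = wedge_form w (of_rat_mat A *v z)"
proof -
  have lin: "linear (v i)" for i using L by (auto simp: H1_rat_def)
  have form_H2: "wedge_form v z \<in> H2_complex" for z by (rule wedge_form_in_H2_complex) (rule lin)
  have add: "\<Psi> (wedge_form v (x + y)) = (\<lambda>u u'. \<Psi> (wedge_form v x) u u' + \<Psi> (wedge_form v y) u u')" for x y
    using \<Psi> form_H2 unfolding wedge_form_add complexification_def by blast
  have scale: "\<Psi> (wedge_form v (c *s x)) = (\<lambda>u u'. c * \<Psi> (wedge_form v x) u u')" for c x
    using \<Psi> form_H2 unfolding wedge_form_scale complexification_def by blast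
  have basis: "\<Psi> (wedge_form v (axis k 1)) = wedge_form w (of_rat_mat A *v axis k 1)" for k
  proof -
    have "of_rat_vec (axis k 1) = (axis k 1 :: complex^6)"
      by (simp add: of_rat_vec_def axis_def vec_eq_iff)
    then have "wedge_form v (axis k 1) \<in> H2_rat L" using wedge_form_in_H2_rat[of v L "axis k 1", OF L] by simp
    then have "\<Psi> (wedge_form v (axis k 1)) = \<psi> (associated_basis v k)"
      using \<Psi> by (simp add: complexification_def wedge_form_axis)
    also have "\<dots> = wedge_form w (column k (of_rat_mat A))"
      using A by (simp add: matrix_wrt_def wedge_form_def column_def of_rat_mat_def)
    finally show ?thesis by (simp only: matrix_vector_mult_axis)
  qed
  have zero: "\<Psi> (wedge_form v 0) = wedge_form w 0"
    using scale[of 0 0] by (simp add: wedge_form_def)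
  have "\<Psi> (wedge_form v (\<Sum>k\<in>S. z$k *s axis k 1)) = wedge_form w (of_rat_mat A *v (\<Sum>k\<in>S. z$k *s axis k 1))" if "finite S" for S
    using that
  proof (induction S)
    case empty
    then show ?case by (simp add: zero)
  next
    case (insert k S)
    then show ?case
      by (simp add: add scale basis matrix_vector_right_distrib vector_scalar_commute)
        (simp add: wedge_form_add wedge_form_scale)
  qed
  from this[of UNIV] show ?thesis by (simp add: basis_expansion)
qed

lemma pullback_wedge_form:
  assumes F: "\<And>i u. v i (F u) = (\<Sum>j\<in>UNIV. of_rat (G$j$i) * w j u)"
    and G: "\<And>x. G ** skew x ** transpose G = skew (d *s (A *v x))"
  shows "wedge_form v z (F u) (F u') = of_rat d * wedge_form w (of_rat_mat A *v z) u u'"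
proof -
  have "wedge_form v z (F u) (F u') = (\<Sum>k\<in>UNIV. z$k * (of_rat d * wedge_form w (of_rat_vec (column k A)) u u'))"
    unfolding wedge_form_def by (simp only: associated_basis_pullback[of v F G w d A, OF F G, unfolded wedge_form_def])
  also have "\<dots> = of_rat d * (\<Sum>k\<in>UNIV. \<Sum>l\<in>UNIV. z$k * (of_rat (A$l$k) * associated_basis w l u u'))"
    by (simp add: wedge_form_def of_rat_vec_def column_def sum_distrib_left mult_ac)
  also have "\<dots> = of_rat d * (\<Sum>l\<in>UNIV. \<Sum>k\<in>UNIV. z$k * (of_rat (A$l$k) * associated_basis w l u u'))"
    by (subst sum.swap) (rule HOL.refl)
  also have "\<dots> = of_rat d * wedge_form w (of_rat_mat A *v z) u u'"
    by (simp add: wedge_form_def of_rat_mat_def matrix_vector_mult_def sum_distrib_left mult_ac)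
  finally show ?thesis .
qed

lemma clinear_of_preserves_H20:
  assumes F: "linear F" "surj F"
    and H20: "(\<lambda>u u'. wedge11 (\<lambda>v. v$1) (\<lambda>v. v$2) (F u) (F u') / d) \<in> H20" and "d \<noteq> 0"
  shows "clinear_map F"
proof -
  let ?\<omega> = "wedge11 (\<lambda>v::cspace. v$1) (\<lambda>v. v$2)"
  let ?\<theta> = "\<lambda>u u'. ?\<omega> (F u) (F u') / d"
  obtain n :: nat and \<phi> \<eta> where \<theta>: "?\<theta> = (\<lambda>u u'. \<Sum>i<n. wedge11 (\<phi> i) (\<eta> i) u u')"
    and hol: "\<And>i. i < n \<Longrightarrow> \<phi> i \<in> H10 \<and> \<eta> i \<in> H10"
    using H20 unfolding H20_def wedge_span_def by blast
  have \<theta>': "?\<theta> u u' = (\<Sum>i<n. wedge11 (\<phi> i) (\<eta> i) u u')" for u u'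
    using fun_cong[OF fun_cong[OF \<theta>]] by simp
  have "?\<theta> (c *s u) u' = c * ?\<theta> u u'" for c u u'
    using hol unfolding \<theta>' by (simp add: sum_distrib_left wedge11_def H10_def right_diff_distrib mult_ac)
  then have \<omega>: "?\<omega> (F (c *s u)) (F u') = c * ?\<omega> (F u) (F u')" for c u u'
    using \<open>d \<noteq> 0\<close> by (simp add: field_simps)
  txt \<open>The form \<open>dz\<^sub>1 \<and> dz\<^sub>2\<close> is complex bilinear and nondegenerate, and \<open>F\<close> is onto.\<close>
  have "F (c *s u) = c *s F u" for c u
  proof -
    have "?\<omega> (F (c *s u)) y = c * ?\<omega> (F u) y" for y
      using \<omega>[of c u] F(2) by (metis surjD)
    \<comment> \<open>Pairing with the two coordinate vectors returns the coordinates of the first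
      argument, up to sign and order.\<close>
    from this[of "axis 1 1"] this[of "axis 2 1"] show ?thesis
      by (simp add: wedge11_def axis_def vec_eq_iff forall_2)
  qed
  with F(1) show ?thesis by (simp add: clinear_map_def)
qed

section \<open>Lifting the isometry\<close>

text \<open>The matrix action of \<open>\<psi>\<close> on rational coordinates is obtained through
  its complexification; admissibility turns the pairing on either side into
  \<open>plucker\<close>.\<close>

lemma isometry_of_hodge_isometry:
  assumes \<psi>: "hodge_isometry X Y \<psi>" and v: "admissible_basis X v" and w: "admissible_basis Y w"
    and A: "matrix_wrt (associated_basis v) (associated_basis w) \<psi> A"
  shows "plucker_isometry A"
  unfolding plucker_isometry_def
proof (intro allI)
  fix x y :: "rat^6"
  obtain \<Psi> where \<Psi>: "complexification X \<psi> \<Psi>" using \<psi> by (auto simp: hodge_isometry_def)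
  have vX: "v i \<in> H1_rat X" for i using v by (auto simp: admissible_basis_def H1_basis_def)
  have rat: "wedge_form v (of_rat_vec x) \<in> H2_rat X" for x by (rule wedge_form_in_H2_rat) (rule vX)
  have "\<psi> (wedge_form v (of_rat_vec x)) = \<Psi> (wedge_form v (of_rat_vec x))" for x
    using \<Psi> rat by (simp add: complexification_def)
  then have \<psi>wedge_form: "\<psi> (wedge_form v (of_rat_vec x)) = wedge_form w (of_rat_vec (A *v x))" for x
    using complexification_wedge_form[of v X \<psi> \<Psi> w A, OF vX \<Psi> A] by (simp add: of_rat_mat_vec)
  have "of_rat (plucker (A *v x) (A *v y)) =
      H2_pairing Y (\<psi> (wedge_form v (of_rat_vec x))) (\<psi> (wedge_form v (of_rat_vec y)))"
    unfolding \<psi>wedge_form by (rule H2_pairing_wedge_form[OF w, symmetric])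
  also have "\<dots> = H2_pairing X (wedge_form v (of_rat_vec x)) (wedge_form v (of_rat_vec y))"
    using \<psi> rat by (simp add: hodge_isometry_def)
  also have "\<dots> = of_rat (plucker x y)" by (rule H2_pairing_wedge_form[OF v])
  finally show "plucker (A *v x) (A *v y) = plucker x y" by simp
qed

lemma scale_matrix_mult:
  fixes M :: "'a::comm_ring_1^'n^'m"
  shows "(\<chi> i j. c * M$i$j) ** S = (\<chi> i j. c * (M ** S)$i$j)"
    and "T ** (\<chi> i j. c * M$i$j) = (\<chi> i j. c * (T ** M)$i$j)"
    and "transpose (\<chi> i j. c * M$i$j) = (\<chi> i j. c * (transpose M)$i$j)"
  by (simp_all add: matrix_matrix_mult_def transpose_def vec_eq_iff sum_distrib_left mult_ac)

text \<open>\<open>P\<close> and \<open>Q\<close> are period matrices, and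
  \<open>P N = G^T Q\<close> says that \<open>N\<close> in lattice bases and \<open>G\<close> on
  one-forms describe the same map. Multiplying \<open>G\<close> by an integer \<open>n\<close>
  replaces \<open>l\<close> by \<open>n^2 l\<close> and \<open>N\<close> by \<open>n N\<close>, so
  the relation \<open>det N = d^2\<close> survives the clearing of denominators.\<close>

lemma integral_lift:
  fixes A :: "rat^6^6" and P Q :: "rat^4^4"
  assumes "plucker_isometry A" "det A = 1" and P: "det P = 1" and Q: "det Q = 1"
  shows "\<exists>(G :: rat^4^4) N (d :: int). d \<noteq> 0 \<and>
    (\<forall>x. G ** skew x ** transpose G = skew (of_int d *s (A *v x))) \<and>
    P ** N = transpose G ** Q \<and> (\<forall>i j. N$i$j \<in> \<int>) \<and> det N = of_int (d\<^sup>2)"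
proof -
  obtain G0 l where G0: "l \<noteq> 0" "det G0 = l\<^sup>2" "\<And>x. G0 ** skew x ** transpose G0 = skew (l *s (A *v x))"
    using isometry_lifts[OF assms(1,2)] by blast
  have "invertible P" using P by (simp add: invertible_det_nz)
  then obtain P' where P': "P ** P' = mat 1" by (auto simp: invertible_def)
  then have "det P * det P' = 1" by (simp only: det_mul [symmetric] det_I)
  then have detP': "det P' = 1" using P by simp
  define N0 where "N0 = P' ** (transpose G0 ** Q)"
  have detN0: "det N0 = l\<^sup>2" by (simp add: N0_def det_mul detP' Q G0)
  have PN0: "P ** N0 = transpose G0 ** Q" by (simp add: N0_def matrix_mul_assoc P')
  \<comment> \<open>Including \<open>l\<close> makes \<open>n l\<close> integral, hence also
    \<open>d = n^2 l\<close>.\<close>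
  let ?S = "insert l (range (\<lambda>(i, j). N0$i$j))"
  have "finite ?S" by simp
  then obtain n :: int where n: "n > 0" "\<And>q. q \<in> ?S \<Longrightarrow> of_int n * q \<in> \<int>"
    using common_denominator by blast
  have "of_int n * l \<in> \<int>" by (rule n(2)) simp
  then obtain m :: int where m: "of_int n * l = of_int m" by (rule Ints_cases)
  define d where "d = n * m"
  have d: "of_int d = (of_int n)\<^sup>2 * l" by (simp add: d_def power2_eq_square mult.assoc m)
  define G :: "rat^4^4" where "G = (\<chi> i j. of_int n * G0$i$j)"
  define N :: "rat^4^4" where "N = (\<chi> i j. of_int n * N0$i$j)"
  show ?thesis
  proof (intro exI conjI allI)
    have "(of_int d :: rat) \<noteq> 0" unfolding d using n(1) G0(1) by simp
    then show "d \<noteq> 0" by simp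
    show "G ** skew x ** transpose G = skew (of_int d *s (A *v x))" for x
    proof -
      have "G ** skew x ** transpose G = (\<chi> i j. (of_int n)\<^sup>2 * (G0 ** skew x ** transpose G0)$i$j)"
        unfolding G_def scale_matrix_mult by (simp add: power2_eq_square mult.assoc)
      also have "\<dots> = skew (of_int d *s (A *v x))"
        unfolding G0(3) d by (simp add: skew_def vec_eq_iff forall_4 mult.assoc)
      finally show ?thesis .
    qed
    show "P ** N = transpose G ** Q"
      unfolding G_def N_def scale_matrix_mult PN0 ..
    show "N$i$j \<in> \<int>" for i j proof -
      have "N0$i$j \<in> ?S" by (auto intro: image_eqI[of _ _ "(i, j)"])
      from n(2)[OF this] show ?thesis by (simp add: N_def)
    qed
    have "det N = (of_int n)^4 * l\<^sup>2" unfolding N_def det_scale detN0 by simp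
    also have "\<dots> = of_int (d\<^sup>2)" unfolding of_int_power d power_mult_distrib by simp
    finally show "det N = of_int (d\<^sup>2)" .
  qed
qed

theorem theorem1p3p1:
  fixes X Y :: "cspace set" and \<psi> :: "form2 \<Rightarrow> form2"
  assumes "abelian_surface X" and "abelian_surface Y"
    and "admissible_isometry X Y \<psi>"
  shows "\<exists>(d::int) f. isogeny Y X f \<and> int (isogeny_degree Y X f) = d\<^sup>2 \<and>
           (\<forall>\<alpha>\<in>H2_rat X. \<psi> \<alpha> = (\<lambda>u v. H2_pullback Y X f \<alpha> u v / of_int d))"
proof -
  have X: "is_lattice X" and Y: "is_lattice Y" using assms(1,2) by (auto simp: abelian_surface_def)
  obtain v w A where \<psi>: "hodge_isometry X Y \<psi>" and v: "admissible_basis X v" and w: "admissible_basis Y w"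
    and A: "matrix_wrt (associated_basis v) (associated_basis w) \<psi> A" and detA: "det A = 1"
    using assms(3) by (auto simp: admissible_isometry_def)
  let ?a = "trace_basis X" and ?b = "trace_basis Y"
  note a = lattice_trace_basis[OF X] and b = lattice_trace_basis[OF Y]
  have vX: "v i \<in> H1_rat X" and wY: "w i \<in> H1_rat Y" for i
    using v w by (auto simp: admissible_basis_def H1_basis_def)
  then have vlin: "linear (v i)" and wlin: "linear (w i)" for i by (auto simp: H1_rat_def)
  obtain P where P: "\<And>i j. v i (?a j) = of_rat (P$i$j)" "det P = 1"
    using admissible_period_matrix[OF X v] by blast
  obtain Q where Q: "\<And>i j. w i (?b j) = of_rat (Q$i$j)" "det Q = 1"
    using admissible_period_matrix[OF Y w] by blast
  obtain G N d where d: "d \<noteq> 0"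
    and G: "\<And>x. G ** skew x ** transpose G = skew (of_int d *s (A *v x))"
    and PN: "P ** N = transpose G ** Q" and N: "\<And>i j. N$i$j \<in> \<int>" "det N = of_int (d\<^sup>2)"
    using integral_lift[OF isometry_of_hodge_isometry[OF \<psi> v w A] detA P(2) Q(2)] by blast
  let ?N = "of_rat_mat N :: real^4^4"
  have Nint: "?N$i$j \<in> \<int>" for i j
    using N(1)[of i j] by (auto simp: of_rat_mat_def elim: Ints_cases)
  have detN: "det ?N = (of_int d)\<^sup>2" by (simp add: det_of_rat_mat N(2) of_rat_power)
  \<comment> \<open>The map goes from \<open>Y\<close> to \<open>X\<close> since cohomology is
    contravariant; its matrix in the lattice bases is \<open>N\<close>.\<close>
  define F where "F u = lin_comb ?a (?N *v inv_into UNIV (lin_comb ?b) u)" for u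
  have Fb: "F (lin_comb ?b x) = lin_comb ?a (?N *v x)" for x
    using lattice_basis_bij[OF b] by (simp add: F_def bij_is_inj)
  have bsurj: "\<exists>x. u = lin_comb ?b x" for u
    using lattice_basis_bij[OF b] by (metis bij_pointE)
  have linF: "linear F"
  proof (rule linearI)
    show "F (p + q) = F p + F q" for p q
      using bsurj[of p] bsurj[of q]
      by (auto simp: linear_add[OF linear_lin_comb, symmetric] Fb matrix_vector_right_distrib)
    show "F (r *\<^sub>R p) = r *\<^sub>R F p" for r p
      using bsurj[of p]
      by (auto simp: linear_cmul[OF linear_lin_comb, symmetric] Fb matrix_vector_mult_scaleR)
  qed
  have "det ?N \<noteq> 0" using detN d by simp
  then have "invertible ?N" by (simp add: invertible_det_nz)
  then obtain N' where N': "?N ** N' = mat 1" by (auto simp: invertible_def)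
  have surjF: "surj F"
  proof (rule surjI)
    show "F (lin_comb ?b (N' *v inv_into UNIV (lin_comb ?a) y)) = y" for y
      using lattice_basis_bij[OF a]
      by (simp add: Fb matrix_vector_mul_assoc N' bij_is_surj surj_f_inv_f)
  qed
  \<comment> \<open>Evaluated in lattice coordinates, this is the matrix relation
    \<open>PN\<close>.\<close>
  have FG: "v i (F u) = (\<Sum>j\<in>UNIV. of_rat (G$j$i) * w j u)" for i u
  proof -
    obtain x where x: "u = lin_comb ?b x" using bsurj by blast
    have ev: "v i (lin_comb ?a y) = of_real ((of_rat_mat P *v y)$i)" for y i
      unfolding linear_lin_comb_eq[OF vlin] P
      by (simp add: of_rat_mat_def matrix_vector_mult_def of_real_of_rat mult.commute)
    have ew: "w j (lin_comb ?b y) = of_real ((of_rat_mat Q *v y)$j)" for y j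
      unfolding linear_lin_comb_eq[OF wlin] Q
      by (simp add: of_rat_mat_def matrix_vector_mult_def of_real_of_rat mult.commute)
    have "v i (F u) = of_real ((of_rat_mat (P ** N) *v x)$i)"
      unfolding x Fb ev of_rat_mat_mult by (simp add: matrix_vector_mul_assoc)
    also have "\<dots> = of_real ((of_rat_mat (transpose G) *v (of_rat_mat Q *v x))$i)"
      unfolding PN of_rat_mat_mult by (simp add: matrix_vector_mul_assoc)
    also have "\<dots> = (\<Sum>j\<in>UNIV. of_rat (G$j$i) * w j u)"
      unfolding x ew
      by (subst matrix_vector_mult_def) (simp add: of_rat_mat_def transpose_def of_real_of_rat)
    finally show ?thesis .
  qed
  obtain \<Psi> where \<Psi>: "complexification X \<psi> \<Psi>" "\<Psi> ` H20 = H20"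
    using \<psi> by (auto simp: hodge_isometry_def)
  \<comment> \<open>Both sides are given by the matrix \<open>A\<close> in coordinates. All complex
    forms are covered because \<open>dz1 ^ dz2\<close> need not be rational.\<close>
  have pull: "\<Psi> \<alpha> = (\<lambda>u u'. \<alpha> (F u) (F u') / of_int d)" if \<alpha>: "\<alpha> \<in> H2_complex" for \<alpha>
  proof -
    obtain z where z: "\<alpha> = wedge_form v z"
      by (rule H2_complex_wedge_form[of X ?a v P \<alpha>, OF a vlin P \<alpha>])
    have "wedge_form v z (F u) (F u') = of_int d * wedge_form w (of_rat_mat A *v z) u u'" for u u'
      using pullback_wedge_form[of v F G w "of_int d" A, OF FG G] by simp
    then show ?thesis
      unfolding z complexification_wedge_form[of v X \<psi> \<Psi> w A, OF vX \<Psi>(1) A] using d by (simp add: fun_eq_iff)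
  qed
  let ?\<omega> = "wedge11 (\<lambda>v::cspace. v$1) (\<lambda>v. v$2)"
  have dz: "(\<lambda>v::cspace. v$k) \<in> H10" for k
    unfolding H10_def H1_complex_def
    using bounded_linear.linear[OF bounded_linear_vec_nth] by simp
  have wedge: "wedge11 \<phi> \<eta> \<in> wedge_span S T" if "\<phi> \<in> S" "\<eta> \<in> T" for \<phi> \<eta> S T
    unfolding wedge_span_def using that
    by (intro CollectI exI[of _ "1::nat"] exI[of _ "\<lambda>_. \<phi>"] exI[of _ "\<lambda>_. \<eta>"]) simp
  then have "?\<omega> \<in> H20" "?\<omega> \<in> H2_complex"
    unfolding H20_def H2_complex_def using dz by (simp_all add: H10_def)
  then have "\<Psi> ?\<omega> \<in> H20" and \<Psi>\<omega>: "\<Psi> ?\<omega> = (\<lambda>u u'. ?\<omega> (F u) (F u') / of_int d)"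
    using \<Psi>(2) pull by blast+
  then have "(\<lambda>u u'. ?\<omega> (F u) (F u') / of_int d) \<in> H20" by (simp only:)
  then have F: "clinear_map F"
    using clinear_of_preserves_H20[OF linF surjF] d by simp
  let ?f = "torus_map Y X F"
  note iso = isogeny_torus_map[OF b a F Fb Nint \<open>det ?N \<noteq> 0\<close>]
  \<comment> \<open>The determinant is a square, so the absolute value disappears whatever the sign
    of \<open>d\<close>.\<close>
  have "real (isogeny_degree Y X ?f) = real_of_int (d\<^sup>2)" using iso(2) detN by simp
  then have "int (isogeny_degree Y X ?f) = d\<^sup>2" by linarith
  moreover have "\<psi> \<alpha> = (\<lambda>u v. H2_pullback Y X ?f \<alpha> u v / of_int d)" if "\<alpha> \<in> H2_rat X" for \<alpha>
  proof -
    have "H1_rat X \<subseteq> H1_complex" by (auto simp: H1_rat_def H1_complex_def)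
    then have "\<alpha> \<in> H2_complex"
      using that unfolding H2_rat_def H2_complex_def wedge_span_def by blast
    moreover have "\<psi> \<alpha> = \<Psi> \<alpha>" using \<Psi>(1) that by (simp add: complexification_def)
    ultimately show ?thesis
      using pull by (simp add: H2_pullback_def analytic_rep_torus_map[OF b a F iso(3)])
  qed
  ultimately show ?thesis using iso(1) by blast
qed

end
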